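(* Let $G$ be a finite group. Then $\mathcal{P}(G)^0$ is finitely based if and only if $|G|\leq 2$.
   Context: An additively idempotent semiring (ai-semiring) is an algebra $(S,+,\cdot)$ with two binary operations (no constants in the signature) such that $(S,+)$ is a commutative idempotent semigroup, $(S,\cdot)$ is a semigroup, and multiplication distributes over addition on both sides. For a semigroup $S$, $\mathcal{P}(S)^0$ is the ai-semiring of all subsets of $S$ (including $\varnothing$) with $A+B=A\cup B$ and $AB=\{ab:a\in A,\ b\in B\}$. An algebra is finitely based if the variety it generates is finitely based, i.e. its identities (in the signature $\{+,\cdot\}$) admit a finite basis. *)

theory Defs
  imports "HOL-Algebra.Coset"
begin

section \<open>Algebras with two binary operations, and their identities\<close>

text \<open>The signature consists of the two binary operations only: zero and one are not named by
  terms. The variables are the natural numbers.\<close>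

record 'a alg = "'a partial_object" +
  sadd :: "'a \<Rightarrow> 'a \<Rightarrow> 'a"
  smul :: "'a \<Rightarrow> 'a \<Rightarrow> 'a"

datatype trm = Var nat | Add trm trm | Mul trm trm

primrec trm_val :: "('a, 'b) alg_scheme \<Rightarrow> (nat \<Rightarrow> 'a) \<Rightarrow> trm \<Rightarrow> 'a" where
  "trm_val A \<phi> (Var x) = \<phi> x"
| "trm_val A \<phi> (Add s t) = sadd A (trm_val A \<phi> s) (trm_val A \<phi> t)"
| "trm_val A \<phi> (Mul s t) = smul A (trm_val A \<phi> s) (trm_val A \<phi> t)"

primrec subst :: "(nat \<Rightarrow> trm) \<Rightarrow> trm \<Rightarrow> trm" where
  "subst \<sigma> (Var x) = \<sigma> x"
| "subst \<sigma> (Add s t) = Add (subst \<sigma> s) (subst \<sigma> t)"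
| "subst \<sigma> (Mul s t) = Mul (subst \<sigma> s) (subst \<sigma> t)"

definition satisfies :: "('a, 'b) alg_scheme \<Rightarrow> trm \<times> trm \<Rightarrow> bool" where
  "satisfies A e \<longleftrightarrow>
     (\<forall>\<phi>. (\<forall>x. \<phi> x \<in> carrier A) \<longrightarrow> trm_val A \<phi> (fst e) = trm_val A \<phi> (snd e))"

text \<open>Consequence is Birkhoff's equational logic. Semantic consequence would quantify over the
  algebras of all types, which a definition in HOL cannot do; the lemmas \<open>deducible_sound\<close> and
  \<open>deducible_complete\<close> below show that the two notions agree.\<close>

inductive deducible :: "(trm \<times> trm) set \<Rightarrow> trm \<Rightarrow> trm \<Rightarrow> bool" for E where
  ax: "(s, t) \<in> E \<Longrightarrow> deducible E (subst \<sigma> s) (subst \<sigma> t)"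
| refl: "deducible E t t"
| sym: "deducible E s t \<Longrightarrow> deducible E t s"
| trans: "deducible E s t \<Longrightarrow> deducible E t u \<Longrightarrow> deducible E s u"
| add: "deducible E s s' \<Longrightarrow> deducible E t t' \<Longrightarrow> deducible E (Add s t) (Add s' t')"
| mul: "deducible E s s' \<Longrightarrow> deducible E t t' \<Longrightarrow> deducible E (Mul s t) (Mul s' t')"

definition finitely_based :: "('a, 'b) alg_scheme \<Rightarrow> bool" where
  "finitely_based A \<longleftrightarrow>
     (\<exists>E. finite E \<and> (\<forall>e \<in> E. satisfies A e) \<and>
          (\<forall>s t. satisfies A (s, t) \<longrightarrow> deducible E s t))"

locale closed_alg =
  fixes A :: "('a, 'b) alg_scheme"
  assumes add_closed: "x \<in> carrier A \<Longrightarrow> y \<in> carrier A \<Longrightarrow> sadd A x y \<in> carrier A"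
    and mul_closed: "x \<in> carrier A \<Longrightarrow> y \<in> carrier A \<Longrightarrow> smul A x y \<in> carrier A"

lemma (in closed_alg) trm_val_closed:
  "(\<And>x. \<phi> x \<in> carrier A) \<Longrightarrow> trm_val A \<phi> t \<in> carrier A"
  by (induction t) (auto intro: add_closed mul_closed)

lemma trm_val_subst: "trm_val A \<phi> (subst \<sigma> t) = trm_val A (\<lambda>x. trm_val A \<phi> (\<sigma> x)) t"
  by (induction t) auto

lemma deducible_sound:
  assumes "closed_alg A" "\<forall>e \<in> E. satisfies A e" "deducible E s t"
  shows "satisfies A (s, t)"
proof -
  have "trm_val A \<phi> s = trm_val A \<phi> t" if \<phi>: "\<And>x. \<phi> x \<in> carrier A" for \<phi>
    using assms(3)
  proof induction
    case (ax s t \<sigma>)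
    then show ?case
      using assms(2) closed_alg.trm_val_closed[OF assms(1), of \<phi>] \<phi>
      by (fastforce simp: satisfies_def trm_val_subst)
  qed auto
  then show ?thesis by (simp add: satisfies_def)
qed

lemma deducible_complete:
  assumes "\<And>A :: trm set alg.
    closed_alg A \<Longrightarrow> \<forall>e \<in> E. satisfies A e \<Longrightarrow> satisfies A (s, t)"
  shows "deducible E s t"
proof -
  define cls where "cls u = {v. deducible E u v}" for u
  define rep where "rep X = (SOME u. cls u = X)" for X
  define A :: "trm set alg" where "A = \<lparr>carrier = range cls,
    sadd = \<lambda>X Y. cls (Add (rep X) (rep Y)), smul = \<lambda>X Y. cls (Mul (rep X) (rep Y))\<rparr>"
  have cls_eq: "cls u = cls v \<longleftrightarrow> deducible E u v" for u v
    unfolding cls_def by (auto intro: deducible.intros)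
  have cls_rep: "cls (rep (cls u)) = cls u" for u
    unfolding rep_def by (rule someI) (rule HOL.refl)
  have ev: "trm_val A \<phi> u = cls (subst (\<lambda>x. rep (\<phi> x)) u)" if "\<And>x. \<phi> x \<in> carrier A" for \<phi> u
  proof (induction u)
    case (Var x)
    then show ?case using that[of x] cls_rep by (auto simp: A_def)
  next
    case (Add u v)
    then show ?case using cls_rep by (auto simp: A_def cls_eq intro: deducible.add)
  next
    case (Mul u v)
    then show ?case using cls_rep by (auto simp: A_def cls_eq intro: deducible.mul)
  qed
  have "closed_alg A"
    by unfold_locales (auto simp: A_def)
  moreover have "\<forall>e \<in> E. satisfies A e"
    by (auto simp: satisfies_def ev cls_eq intro: deducible.ax)
  ultimately have sat: "satisfies A (s, t)"
    by (rule assms)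
  have "deducible E u (subst (\<lambda>x. rep (cls (Var x))) u)" for u
    using cls_rep cls_eq by (induction u) (auto intro: deducible.intros)
  moreover have "deducible E (subst (\<lambda>x. rep (cls (Var x))) s) (subst (\<lambda>x. rep (cls (Var x))) t)"
  proof -
    have "\<And>x. cls (Var x) \<in> carrier A" by (simp add: A_def)
    then show ?thesis
      using sat by (simp add: satisfies_def ev flip: cls_eq)
  qed
  ultimately show ?thesis
    by (meson deducible.sym deducible.trans)
qed

section \<open>Additively idempotent semirings of subsets\<close>

locale ai_semiring = closed_alg +
  assumes add_assoc: "\<lbrakk>x \<in> carrier A; y \<in> carrier A; z \<in> carrier A\<rbrakk>
      \<Longrightarrow> sadd A (sadd A x y) z = sadd A x (sadd A y z)"
    and add_comm: "\<lbrakk>x \<in> carrier A; y \<in> carrier A\<rbrakk> \<Longrightarrow> sadd A x y = sadd A y x"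
    and add_idem: "x \<in> carrier A \<Longrightarrow> sadd A x x = x"
    and mul_assoc: "\<lbrakk>x \<in> carrier A; y \<in> carrier A; z \<in> carrier A\<rbrakk>
      \<Longrightarrow> smul A (smul A x y) z = smul A x (smul A y z)"
    and distrib_left: "\<lbrakk>x \<in> carrier A; y \<in> carrier A; z \<in> carrier A\<rbrakk>
      \<Longrightarrow> smul A x (sadd A y z) = sadd A (smul A x y) (smul A x z)"
    and distrib_right: "\<lbrakk>x \<in> carrier A; y \<in> carrier A; z \<in> carrier A\<rbrakk>
      \<Longrightarrow> smul A (sadd A x y) z = sadd A (smul A x z) (smul A y z)"

definition power_alg :: "('a, 'b) monoid_scheme \<Rightarrow> 'a set alg" where
  "power_alg G = \<lparr>carrier = Pow (carrier G), sadd = (\<union>), smul = set_mult G\<rparr>"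

lemma (in group) ai_semiring_power_alg: "ai_semiring (power_alg G)"
  by unfold_locales
    (auto simp: power_alg_def set_mult_assoc set_mult_closed, auto simp: set_mult_def)

end

theory Submission
  imports Defs "HOL-Algebra.Multiplicative_Group" "HOL-Library.Ramsey"
    "HOL-Library.Nat_Bijection" "HOL-Library.Multiset"
begin

text \<open>If \<open>|G| \<ge> 3\<close>, take a family of sets of variables such that every assignment of subsets of
  \<open>G\<close> is constant on some set of the family (Ramsey). Then the product of all variables lies
  below the sum of its variants in which the variables of one set of the family are merged. The
  words of the variants are determined, modulo the order \<open>n\<close> of some group element, by their
  contents, and the content of the full product is not among these. The family can be chosen so
  that among any \<open>q\<close> of its sets each has a private element; then at most \<open>q\<close> words of this kind
  never bound a word of another kind, since elements of \<open>G\<close> separate their values. Identities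
  of bounded size therefore preserve the set of variants and do not prove the inequality.

  If \<open>|G| \<le> 2\<close>, then \<open>abc \<in> {a, b, c}\<close> for all group elements, so products of three
  are bounded by sums. By linear algebra over the field with two elements, this inequality,
  commutativity and \<open>x\<^sup>3 = x\<close> (and absorption for the trivial group) generate every valid
  inequality between a word and a term.\<close>

section \<open>Words\<close>

text \<open>Evaluation in the algebra of languages, with union and concatenation, under the
  assignment \<open>F\<close>; empty languages are allowed. Singleton letters expand a term into its
  words.\<close>

primrec wds :: "(nat \<Rightarrow> nat list set) \<Rightarrow> trm \<Rightarrow> nat list set" where
  "wds F (Var x) = F x"
| "wds F (Add s t) = wds F s \<union> wds F t"
| "wds F (Mul s t) = {u @ v | u v. u \<in> wds F s \<and> v \<in> wds F t}"

abbreviation words :: "trm \<Rightarrow> nat list set" where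
  "words \<equiv> wds (\<lambda>x. {[x]})"

text \<open>The value at the empty word is junk: no term has the empty word.\<close>

primrec word_trm :: "nat list \<Rightarrow> trm" where
  "word_trm [] = Var 0"
| "word_trm (x # xs) = (if xs = [] then Var x else Mul (Var x) (word_trm xs))"

lemma wds_subst: "wds F (subst \<sigma> t) = wds (\<lambda>x. wds F (\<sigma> x)) t"
  by (induction t) auto

lemma wds_mono:
  assumes "\<And>x. F x \<subseteq> F' x"
  shows "wds F t \<subseteq> wds F' t"
  using assms by (induction t) (simp, simp, blast, simp, blast)

lemma words_nonempty: "w \<in> words t \<Longrightarrow> w \<noteq> []"
  by (induction t arbitrary: w) auto

lemma words_word_trm: "w \<noteq> [] \<Longrightarrow> words (word_trm w) = {w}"
  by (induction w) auto

lemma trm_of_words: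
  assumes "finite W" "W \<noteq> {}" "[] \<notin> W"
  obtains t where "words t = W"
proof -
  have "\<exists>t. words t = W"
    using assms
  proof (induction rule: finite_ne_induct)
    case (singleton w)
    then show ?case using words_word_trm by (metis insertI1)
  next
    case (insert w W)
    then obtain t where "words t = W" by blast
    then have "words (Add (word_trm w) t) = insert w W"
      using insert.prems words_word_trm[of w] by auto
    then show ?case by blast
  qed
  then show ?thesis using that by blast
qed

text \<open>Each occurrence of a variable contributes at most one factor to a given word, and there
  are at most \<open>Suc (size t)\<close> occurrences.\<close>

lemma wds_select:
  assumes "w \<in> wds F t"
  obtains F' where "\<And>x. F' x \<subseteq> F x" "\<And>x. finite (F' x)" "\<And>x. card (F' x) \<le> Suc (size t)"
    "w \<in> wds F' t"
proof -
  have "\<exists>F'. (\<forall>x. F' x \<subseteq> F x \<and> finite (F' x) \<and> card (F' x) \<le> Suc (size t)) \<and> w \<in> wds F' t"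
    using assms
  proof (induction t arbitrary: w)
    case (Var x)
    then show ?case by (intro exI[of _ "\<lambda>y. if y = x then {w} else {}"]) auto
  next
    case (Add s t)
    then consider "w \<in> wds F s" | "w \<in> wds F t" by auto
    then show ?case
    proof cases
      case 1
      then obtain F' where "\<forall>x. F' x \<subseteq> F x \<and> finite (F' x) \<and> card (F' x) \<le> Suc (size s)"
        "w \<in> wds F' s"
        using Add.IH(1) by blast
      then show ?thesis by (intro exI[of _ F']) (auto intro: le_trans)
    next
      case 2
      then obtain F' where "\<forall>x. F' x \<subseteq> F x \<and> finite (F' x) \<and> card (F' x) \<le> Suc (size t)"
        "w \<in> wds F' t"
        using Add.IH(2) by blast
      then show ?thesis by (intro exI[of _ F']) (auto intro: le_trans)
    qed
  next
    case (Mul s t)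
    then obtain u v where uv: "u \<in> wds F s" "v \<in> wds F t" "w = u @ v" by auto
    obtain F1 where F1: "\<And>x. F1 x \<subseteq> F x \<and> finite (F1 x) \<and> card (F1 x) \<le> Suc (size s)"
      "u \<in> wds F1 s"
      using Mul.IH(1)[OF uv(1)] by blast
    obtain F2 where F2: "\<And>x. F2 x \<subseteq> F x \<and> finite (F2 x) \<and> card (F2 x) \<le> Suc (size t)"
      "v \<in> wds F2 t"
      using Mul.IH(2)[OF uv(2)] by blast
    let ?F = "\<lambda>x. F1 x \<union> F2 x"
    have "u \<in> wds ?F s" "v \<in> wds ?F t"
      using wds_mono[of F1 ?F s] wds_mono[of F2 ?F t] F1 F2 by blast+
    moreover have "card (?F x) \<le> Suc (size (Mul s t))" for x
      using card_Un_le[of "F1 x" "F2 x"] F1(1)[of x] F2(1)[of x] by simp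
    ultimately show ?case
      using F1(1) F2(1) uv(3) by (intro exI[of _ ?F]) auto
  qed
  then show ?thesis using that by blast
qed

text \<open>Depends on the term and \<open>b\<close> only, so one bound serves all substitution
  instances of an identity.\<close>

primrec words_bound :: "nat \<Rightarrow> trm \<Rightarrow> nat" where
  "words_bound b (Var x) = b"
| "words_bound b (Add s t) = words_bound b s + words_bound b t"
| "words_bound b (Mul s t) = words_bound b s * words_bound b t"

lemma card_wds:
  assumes "\<And>x. finite (F x)" "\<And>x. card (F x) \<le> b"
  shows "finite (wds F t) \<and> card (wds F t) \<le> words_bound b t"
proof (induction t)
  case (Var x)
  then show ?case using assms by simp
next
  case (Add s t)
  then show ?case using card_Un_le[of "wds F s" "wds F t"] by simp
next
  case (Mul s t)
  have "wds F (Mul s t) = (\<lambda>(u, v). u @ v) ` (wds F s \<times> wds F t)" by auto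
  then show ?case
    using Mul card_image_le[of "wds F s \<times> wds F t" "\<lambda>(u, v). u @ v"]
    by (auto simp: card_cartesian_product intro: le_trans[OF _ mult_le_mono])
qed

section \<open>Values of terms in algebras of subsets\<close>

lemma (in ai_semiring) trm_val_word_trm_append:
  assumes "\<And>x. \<phi> x \<in> carrier A" "u \<noteq> []" "v \<noteq> []"
  shows "trm_val A \<phi> (word_trm (u @ v)) = smul A (trm_val A \<phi> (word_trm u)) (trm_val A \<phi> (word_trm v))"
  using assms(2)
proof (induction u)
  case (Cons x u)
  then show ?case
    using assms(1,3) by (cases "u = []") (auto simp: mul_assoc trm_val_closed)
qed simp

text \<open>The extension of \<open>\<gamma>\<close> to a homomorphism from the free monoid.\<close>

definition wprod :: "('a, 'b) monoid_scheme \<Rightarrow> (nat \<Rightarrow> 'a) \<Rightarrow> nat list \<Rightarrow> 'a" where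
  "wprod G \<gamma> w = foldr (\<lambda>v a. \<gamma> v \<otimes>\<^bsub>G\<^esub> a) w \<one>\<^bsub>G\<^esub>"

lemma wprod_simps [simp]:
  "wprod G \<gamma> [] = \<one>\<^bsub>G\<^esub>" "wprod G \<gamma> (v # w) = \<gamma> v \<otimes>\<^bsub>G\<^esub> wprod G \<gamma> w"
  by (simp_all add: wprod_def)

context group
begin

text \<open>Products of subsets distribute over arbitrary unions.\<close>

lemma trm_val_power_alg_words:
  assumes "\<And>x. \<phi> x \<subseteq> carrier G"
  shows "trm_val (power_alg G) \<phi> t = (\<Union>w\<in>words t. trm_val (power_alg G) \<phi> (word_trm w))"
proof (induction t)
  case (Mul s t)
  interpret P: ai_semiring "power_alg G" by (rule ai_semiring_power_alg)
  have \<phi>: "\<And>x. \<phi> x \<in> carrier (power_alg G)"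
    using assms by (simp add: power_alg_def)
  let ?f = "\<lambda>w. trm_val (power_alg G) \<phi> (word_trm w)"
  have app: "?f (u @ v) = ?f u <#> ?f v" if "u \<in> words s" "v \<in> words t" for u v
    using P.trm_val_word_trm_append[OF \<phi>, of u v] words_nonempty that
    by (auto simp: power_alg_def)
  have "trm_val (power_alg G) \<phi> (Mul s t) = (\<Union>u\<in>words s. ?f u) <#> (\<Union>v\<in>words t. ?f v)"
    using Mul by (simp add: power_alg_def)
  also have "\<dots> = (\<Union>u\<in>words s. \<Union>v\<in>words t. ?f u <#> ?f v)"
    unfolding set_mult_def by blast
  also have "\<dots> = (\<Union>u\<in>words s. \<Union>v\<in>words t. ?f (u @ v))"
    using app by simp
  also have "\<dots> = (\<Union>w\<in>words (Mul s t). ?f w)"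
    by auto
  finally show ?case .
qed (auto simp: power_alg_def)

lemma wprod_closed:
  assumes "\<And>v. \<gamma> v \<in> carrier G"
  shows "wprod G \<gamma> w \<in> carrier G"
  using assms by (induction w) auto

lemma wprod_append:
  assumes "\<And>v. \<gamma> v \<in> carrier G"
  shows "wprod G \<gamma> (u @ v) = wprod G \<gamma> u \<otimes> wprod G \<gamma> v"
  using assms wprod_closed[OF assms] by (induction u) (auto simp: m_assoc)

text \<open>A monoid homomorphism, applied elementwise to languages, preserves union and
  product.\<close>

lemma trm_val_power_alg_image:
  assumes "\<And>v. \<gamma> v \<in> carrier G"
  shows "trm_val (power_alg G) (\<lambda>x. wprod G \<gamma> ` F x) t = wprod G \<gamma> ` wds F t"
proof (induction t)
  case (Mul s t)
  have "wprod G \<gamma> ` wds F s <#> wprod G \<gamma> ` wds F t = wprod G \<gamma> ` wds F (Mul s t)"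
    by (force simp: set_mult_def wprod_append[OF assms])
  then show ?case using Mul by (simp add: power_alg_def)
qed (auto simp: power_alg_def)

end

section \<open>A Ramsey family of sets with private elements\<close>

text \<open>The elements of \<open>V\<close> encode \<open>r\<close>-subsets of
  \<open>{..<N}\<close>; every \<open>k\<close>-subset \<open>S\<close>, where
  \<open>k = r + 1\<close>, gives the set of its \<open>r\<close>-subsets. Constancy on such a set
  is Ramsey's theorem for hypergraphs. A private element of the set given by \<open>S\<close> is an
  \<open>r\<close>-subset of \<open>S\<close> that contains, for each competing
  \<open>k\<close>-subset, a point outside it.\<close>

lemma ramsey_family_with_private_elements:
  fixes C q n :: nat
  assumes "n > 0"
  obtains V :: "nat set" and \<I> where "finite V" "\<And>I. I \<in> \<I> \<Longrightarrow> I \<subseteq> V"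
    "\<And>I. I \<in> \<I> \<Longrightarrow> I \<noteq> {} \<and> n dvd card I"
    "\<And>\<J> I. \<lbrakk>\<J> \<subseteq> \<I>; card \<J> \<le> q; I \<in> \<J>\<rbrakk> \<Longrightarrow> \<exists>v\<in>I. \<forall>I'\<in>\<J>. v \<in> I' \<longrightarrow> I' = I"
    "\<And>f. f ` V \<subseteq> {..<C} \<Longrightarrow> \<exists>I\<in>\<I>. \<exists>c. \<forall>v\<in>I. f v = c"
proof -
  \<comment> \<open>The factor \<open>n\<close> gives divisibility, as a \<open>k\<close>-set has
    \<open>k\<close> subsets of size \<open>r\<close>. The factor \<open>Suc q\<close> makes
    \<open>r \<ge> q\<close>, enough room for a point against each competitor.\<close>
  define k where "k = n * Suc q"
  define r where "r = k - 1"
  have k: "k = Suc r" and qr: "q \<le> r"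
    using assms by (auto simp: k_def r_def) (cases n; simp)
  obtain N :: nat where N: "partn_lst {..<N} (replicate C k) r"
    using ramsey_full by blast
  define V where "V = set_encode ` nsets {..<N} r"
  define \<I> where "\<I> = (\<lambda>S. set_encode ` nsets S r) ` nsets {..<N} k"
  \<comment> \<open>\<open>set_encode\<close> is injective on finite sets; membership in
    \<open>nsets\<close> provides finiteness.\<close>
  have enc: "X = Y" if "set_encode X = set_encode Y" "X \<in> nsets S r" "Y \<in> nsets T r" for X Y S T
    using that by (metis (mono_tags, lifting) mem_Collect_eq nsets_def set_encode_inverse)
  have cardI: "card (set_encode ` nsets S r) = k" if "S \<in> nsets {..<N} k" for S
  proof -
    have "inj_on set_encode (nsets S r)" using enc by (meson inj_onI)
    then have "card (set_encode ` nsets S r) = card (nsets S r)" by (rule card_image)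
    also have "\<dots> = k choose r" using that by (auto simp: nsets_def[of "{..<N}"])
    also have "\<dots> = k" by (simp add: k)
    finally show ?thesis .
  qed
  show ?thesis
  proof
    show "finite V" by (simp add: V_def finite_imp_finite_nsets)
    show "I \<subseteq> V" if "I \<in> \<I>" for I
      using that unfolding V_def \<I>_def by (auto simp: nsets_def)
    show "I \<noteq> {} \<and> n dvd card I" if "I \<in> \<I>" for I
    proof -
      have "card I = k" using that cardI unfolding \<I>_def by blast
      moreover have "n dvd k" unfolding k_def by simp
      ultimately show ?thesis using k by auto
    qed
    show "\<exists>I\<in>\<I>. \<exists>c. \<forall>v\<in>I. f v = c" if "f ` V \<subseteq> {..<C}" for f
    proof -
      have "f \<circ> set_encode \<in> nsets {..<N} r \<rightarrow> {..<C}"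
        using that unfolding V_def by fastforce
      then obtain i H where "i < C" "H \<in> nsets {..<N} k" "(f \<circ> set_encode) ` nsets H r \<subseteq> {i}"
        using partn_lstE[OF N, of "f \<circ> set_encode" C] by (auto simp: nth_replicate)
      then have "\<forall>v\<in>set_encode ` nsets H r. f v = i" "set_encode ` nsets H r \<in> \<I>"
        unfolding \<I>_def by auto
      then show ?thesis by blast
    qed
    show "\<exists>v\<in>I. \<forall>I'\<in>\<J>. v \<in> I' \<longrightarrow> I' = I" if J: "\<J> \<subseteq> \<I>" "card \<J> \<le> q" "I \<in> \<J>" for \<J> I
    proof -
      have finJ: "finite \<J>"
        using J(1) finite_subset by (fastforce simp: \<I>_def finite_imp_finite_nsets)
      obtain S where S: "S \<in> nsets {..<N} k" "I = set_encode ` nsets S r"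
        using J unfolding \<I>_def by blast
      have "\<exists>S' a. S' \<in> nsets {..<N} k \<and> I' = set_encode ` nsets S' r \<and> a \<in> S \<and> a \<notin> S'"
        if I': "I' \<in> \<J> - {I}" for I'
      proof -
        obtain S' where S': "S' \<in> nsets {..<N} k" "I' = set_encode ` nsets S' r"
          using J I' unfolding \<I>_def by blast
        then have "S \<noteq> S'" using S(2) I' by blast
        then have "\<not> S \<subseteq> S'"
          using S(1) S'(1) by (metis (mono_tags, lifting) card_subset_eq mem_Collect_eq nsets_def)
        then show ?thesis using S' by blast
      qed
      then obtain T a where Ta: "\<And>I'. I' \<in> \<J> - {I} \<Longrightarrow>
          T I' \<in> nsets {..<N} k \<and> I' = set_encode ` nsets (T I') r \<and> a I' \<in> S \<and> a I' \<notin> T I'"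
        by metis
      have "card (a ` (\<J> - {I})) \<le> r"
        using card_image_le[of "\<J> - {I}" a] card_Diff1_le[of \<J> I] finJ J(2) qr by simp
      moreover have "a ` (\<J> - {I}) \<subseteq> S" using Ta by blast
      moreover have "finite S" "card S = k" using S(1) by (auto simp: nsets_def)
      ultimately obtain X where X: "a ` (\<J> - {I}) \<subseteq> X" "X \<subseteq> S" "card X = r"
        using exists_subset_between[of "a ` (\<J> - {I})" r S] k by auto
      have XS: "X \<in> nsets S r" using X \<open>finite S\<close> finite_subset by (auto simp: nsets_def)
      have "I' = I" if "I' \<in> \<J>" "set_encode X \<in> I'" for I'
      proof (rule ccontr)
        assume "I' \<noteq> I"
        then have I': "I' \<in> \<J> - {I}" using that by blast
        then obtain Y where "Y \<in> nsets (T I') r" "set_encode X = set_encode Y"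
          using Ta[OF I'] \<open>set_encode X \<in> I'\<close> by blast
        then have "X \<subseteq> T I'" using enc XS by (metis (mono_tags, lifting) mem_Collect_eq nsets_def)
        then show False using Ta[OF I'] X(1) I' by blast
      qed
      then show ?thesis using XS S(2) by blast
    qed
  qed
qed

section \<open>Separating words by their values in a group\<close>

text \<open>For \<open>I \<subseteq> V\<close>, the deviation of the content of \<open>w\<close>
  from the indicator function of \<open>V - I\<close>.\<close>

definition defect :: "nat set \<Rightarrow> nat set \<Rightarrow> nat list \<Rightarrow> nat \<Rightarrow> int" where
  "defect V I w v = int (count_list w v) + of_bool (v \<in> I) - of_bool (v \<in> V)"

text \<open>Modulo \<open>n\<close>, this is the content of the product over \<open>V\<close> with
  the letters of \<open>I\<close> merged, provided that \<open>n\<close> divides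
  \<open>card I\<close>.\<close>

definition content_cong :: "nat \<Rightarrow> nat set \<Rightarrow> nat set \<Rightarrow> nat list \<Rightarrow> bool" where
  "content_cong n V I w \<longleftrightarrow> (\<forall>v. int n dvd defect V I w v)"

context group
begin

text \<open>Only powers of \<open>x\<close> are multiplied, so the positions of the letters do not
  matter.\<close>

lemma wprod_indicator:
  assumes "x \<in> carrier G" "finite X"
  shows "wprod G (\<lambda>v. if v \<in> X then x else \<one>) w = x [^] (\<Sum>v\<in>X. int (count_list w v))"
proof (induction w)
  case (Cons z w)
  have "(\<Sum>v\<in>X. int (count_list (z # w) v)) = (\<Sum>v\<in>X. int (count_list w v)) + of_bool (z \<in> X)"
  proof -
    have "(\<Sum>v\<in>X. int (count_list (z # w) v)) =
        (\<Sum>v\<in>X. int (count_list w v) + (if v = z then 1 else 0))"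
      by (rule sum.cong) auto
    then show ?thesis using assms(2) by (simp add: sum.distrib)
  qed
  then show ?case
    using Cons assms(1) int_pow_mult[OF assms(1), of 1] by (auto simp: add.commute[of 1])
qed simp

text \<open>The value determines the number of letters from \<open>X\<close> modulo
  \<open>ord x\<close>. The indicator terms in the defects of \<open>w\<close> and \<open>u\<close>
  cancel, so equal values would give congruent sums of defects, and the sum for \<open>u\<close>
  vanishes.\<close>

lemma wprod_indicator_neq:
  assumes "x \<in> carrier G" "finite X" "content_cong (ord x) V I u"
    and "\<not> int (ord x) dvd (\<Sum>v\<in>X. defect V I w v)"
  shows "wprod G (\<lambda>v. if v \<in> X then x else \<one>) w \<noteq> wprod G (\<lambda>v. if v \<in> X then x else \<one>) u"
proof
  assume "wprod G (\<lambda>v. if v \<in> X then x else \<one>) w = wprod G (\<lambda>v. if v \<in> X then x else \<one>) u"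
  then have "int (ord x) dvd (\<Sum>v\<in>X. int (count_list w v)) - (\<Sum>v\<in>X. int (count_list u v))"
    using wprod_indicator[OF assms(1,2)] int_pow_eq[OF assms(1)] by metis
  moreover have "int (ord x) dvd (\<Sum>v\<in>X. defect V I u v)"
    using assms(3) by (auto simp: content_cong_def intro: dvd_sum)
  ultimately have "int (ord x) dvd (\<Sum>v\<in>X. int (count_list w v)) -
      (\<Sum>v\<in>X. int (count_list u v)) + (\<Sum>v\<in>X. defect V I u v)"
    by (rule dvd_add)
  also have "\<dots> = (\<Sum>v\<in>X. defect V I w v)"
    by (simp add: defect_def sum.distrib sum_subtractf)
  finally show False using assms(4) by simp
qed

lemma wprod_two_letters:
  assumes "x \<in> carrier G" "y \<in> carrier G" "x \<otimes> y = y \<otimes> x" "a \<noteq> b"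
  shows "wprod G (\<lambda>v. if v = a then x else if v = b then y else \<one>) w =
    x [^] count_list w a \<otimes> y [^] count_list w b"
proof (induction w)
  case (Cons z w)
  let ?X = "x [^] count_list w a" and ?Y = "y [^] count_list w b"
  have "y \<otimes> (?X \<otimes> ?Y) = (y \<otimes> ?X) \<otimes> ?Y"
    using assms by (simp add: m_assoc)
  also have "y \<otimes> ?X = ?X \<otimes> y"
    using group_commutes_pow[OF assms(3,1,2)] by simp
  also have "(?X \<otimes> y) \<otimes> ?Y = ?X \<otimes> (y \<otimes> ?Y)"
    using assms by (simp add: m_assoc)
  finally have "y \<otimes> (?X \<otimes> ?Y) = ?X \<otimes> (y \<otimes> ?Y)" .
  moreover have "x \<otimes> (?X \<otimes> ?Y) = (x \<otimes> ?X) \<otimes> ?Y"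
    using assms by (simp add: m_assoc)
  moreover have "wprod G (\<lambda>v. if v = a then x else if v = b then y else \<one>) w = ?X \<otimes> ?Y"
    by (rule Cons)
  ultimately show ?case
    using assms(1,2,4) nat_pow_Suc2[OF assms(1)] nat_pow_Suc2[OF assms(2)]
    by (cases "z = a"; cases "z = b") (simp_all del: nat_pow_Suc)
qed simp

lemma pow_eq_mod:
  assumes "x \<in> carrier G" "x [^] n = \<one>" "int n dvd int a - int b"
  shows "x [^] a = x [^] b"
proof -
  have "int (ord x) dvd int a - int b"
    using assms pow_eq_id dvd_trans int_dvd_int_iff by blast
  then have "x [^] int b = x [^] int a"
    using int_pow_eq[OF assms(1)] by blast
  then show ?thesis by (simp add: int_pow_int)
qed

text \<open>Let \<open>m I\<close> be the count of \<open>w\<close> at the private element of \<open>I\<close>. Modulo \<open>n\<close>,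
  some \<open>m I\<close> is neither \<open>0\<close> nor \<open>1\<close>, or at least two of them are \<open>0\<close> (only here the
  second group element is needed), or exactly one is \<open>0\<close>, or all are \<open>1\<close>.\<close>

lemma separating_assignment:
  assumes x: "x \<in> carrier G" "ord x = n" "n \<ge> 2"
    and y: "y \<in> carrier G" "x \<otimes> y = y \<otimes> x" "y [^] n = \<one>" "y \<noteq> \<one>" "x \<otimes> y \<noteq> \<one>"
    and \<J>: "finite \<J>" "\<And>I. I \<in> \<J> \<Longrightarrow> I \<subseteq> V"
    and priv: "\<And>I. I \<in> \<J> \<Longrightarrow> \<exists>v\<in>I. \<forall>I'\<in>\<J>. v \<in> I' \<longrightarrow> I' = I"
    and w: "\<And>I. I \<in> \<J> \<Longrightarrow> \<not> content_cong n V I w"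
  obtains \<gamma> where "\<And>v. \<gamma> v \<in> carrier G"
    "\<And>I u. \<lbrakk>I \<in> \<J>; content_cong n V I u\<rbrakk> \<Longrightarrow> wprod G \<gamma> w \<noteq> wprod G \<gamma> u"
proof -
  note thesisI = that
  obtain p where p: "\<And>I. I \<in> \<J> \<Longrightarrow> p I \<in> I" "\<And>I I'. \<lbrakk>I \<in> \<J>; I' \<in> \<J>; p I \<in> I'\<rbrakk> \<Longrightarrow> I' = I"
    using priv by metis
  have pV: "p I \<in> V" if "I \<in> \<J>" for I using p \<J>(2) that by blast
  have inj: "inj_on p \<J>" using p by (metis inj_onI)
  have n1: "\<not> int n dvd 1" "\<not> int n dvd -1" using x(3) by auto
  \<comment> \<open>All cases except that of two zeros use \<open>x\<close> on a set
    \<open>X\<close> of letters and \<open>\<one>\<close> elsewhere. It suffices that the defects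
    over \<open>X\<close> have a nonzero sum modulo \<open>n\<close> for every
    \<open>I\<close>.\<close>
  have indicator: ?thesis
    if "finite X" and nd: "\<And>I. I \<in> \<J> \<Longrightarrow> \<not> int n dvd (\<Sum>v\<in>X. defect V I w v)" for X
  proof (rule thesisI)
    show "(if v \<in> X then x else \<one>) \<in> carrier G" for v using x(1) by simp
    show "wprod G (\<lambda>v. if v \<in> X then x else \<one>) w \<noteq> wprod G (\<lambda>v. if v \<in> X then x else \<one>) u"
      if "I \<in> \<J>" "content_cong n V I u" for I u
      using wprod_indicator_neq[OF x(1) \<open>finite X\<close>, of V I u w] that x(2) nd by blast
  qed
  define m where "m I = int (count_list w (p I))" for I
  \<comment> \<open>A private element \<open>p J\<close> lies in \<open>V\<close>, and in
    \<open>I\<close> only if \<open>J = I\<close>.\<close>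
  have dp: "defect V I w (p J) = m J - 1 + of_bool (J = I)" if "I \<in> \<J>" "J \<in> \<J>" for I J
    using that p pV by (auto simp: defect_def m_def)
  show ?thesis
  proof (cases "\<exists>J\<in>\<J>. \<not> int n dvd m J \<and> \<not> int n dvd m J - 1")
    case True
    then obtain J where J: "J \<in> \<J>" "\<not> int n dvd m J" "\<not> int n dvd m J - 1" by blast
    show ?thesis by (rule indicator[of "{p J}"]) (use J dp in auto)
  next
    case False
    then have m1: "int n dvd m J - 1" if "J \<in> \<J>" "\<not> int n dvd m J" for J using that by blast
    consider (two) A B where "A \<in> \<J>" "B \<in> \<J>" "A \<noteq> B" "int n dvd m A" "int n dvd m B"
      | (one) A where "A \<in> \<J>" "int n dvd m A" "\<And>J. J \<in> \<J> - {A} \<Longrightarrow> \<not> int n dvd m J"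
      | (none) "\<And>J. J \<in> \<J> \<Longrightarrow> \<not> int n dvd m J"
      by blast
    then show ?thesis
    proof cases
      case none
      \<comment> \<open>Over all private elements, the terms \<open>m J - 1\<close> vanish modulo
        \<open>n\<close>, and the private element of \<open>I\<close> adds one.\<close>
      have "(\<Sum>v\<in>p ` \<J>. defect V I w v) = (\<Sum>J\<in>\<J>. m J - 1) + 1" if "I \<in> \<J>" for I
        using that dp \<J>(1) by (simp add: sum.reindex[OF inj] sum.distrib of_bool_def)
      moreover have "int n dvd (\<Sum>J\<in>\<J>. m J - 1)"
        using none m1 by (intro dvd_sum) blast
      ultimately show ?thesis
        using n1 \<J>(1) by (intro indicator[of "p ` \<J>"]) (auto simp: dvd_add_right_iff)
    next
      case one
      obtain v where v: "\<not> int n dvd defect V A w v"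
        using w[OF one(1)] by (auto simp: content_cong_def)
      \<comment> \<open>The letter \<open>v\<close> alone handles \<open>A\<close>, and
        \<open>\<K>\<close> collects the sets for which it fails. For \<open>I\<close> in
        \<open>\<K>\<close>, the private element of \<open>I\<close> adds one to a vanishing defect;
        for any other \<open>I\<close>, the nonzero defect at \<open>v\<close> survives.\<close>
      define \<K> where "\<K> = {J \<in> \<J> - {A}. int n dvd defect V J w v}"
      have \<K>: "\<K> \<subseteq> \<J>" "finite \<K>" "A \<notin> \<K>" using \<J>(1) by (auto simp: \<K>_def)
      \<comment> \<open>At the private element of a \<open>J \<noteq> A\<close> the defect relative
        to \<open>A\<close> vanishes modulo \<open>n\<close>.\<close>
      have vp: "v \<notin> p ` \<K>"
      proof
        assume "v \<in> p ` \<K>"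
        then obtain J where J: "J \<in> \<J> - {A}" "v = p J" by (auto simp: \<K>_def)
        then have "defect V A w v = m J - 1" using dp one(1) by simp
        then show False using v J m1 one(3) by simp
      qed
      have "\<not> int n dvd (\<Sum>u\<in>insert v (p ` \<K>). defect V I w u)" if I: "I \<in> \<J>" for I
      proof -
        have "(\<Sum>u\<in>p ` \<K>. defect V I w u) = (\<Sum>J\<in>\<K>. m J - 1) + of_bool (I \<in> \<K>)"
          using I dp \<K> inj_on_subset[OF inj \<K>(1)]
          by (auto simp: sum.reindex sum.distrib of_bool_def subset_iff)
        then have eq: "(\<Sum>u\<in>insert v (p ` \<K>). defect V I w u) =
            (\<Sum>J\<in>\<K>. m J - 1) + (defect V I w v + of_bool (I \<in> \<K>))"
          using vp \<K>(2) by simp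
        have "int n dvd (\<Sum>J\<in>\<K>. m J - 1)"
          using one(3) m1 by (intro dvd_sum) (auto simp: \<K>_def)
        moreover have "\<not> int n dvd defect V I w v + of_bool (I \<in> \<K>)"
          using v I n1 by (auto simp: \<K>_def dvd_add_right_iff)
        ultimately show ?thesis
          unfolding eq by (simp add: dvd_add_right_iff)
      qed
      then show ?thesis using \<K>(2) by (intro indicator[of "insert v (p ` \<K>)"]) auto
    next
      case two
      \<comment> \<open>Both counts of \<open>w\<close> vanish modulo \<open>n\<close>, so
        \<open>w\<close> has the value \<open>\<one>\<close>. Words \<open>u\<close> for
        \<open>I = A\<close>, for \<open>I = B\<close> and for any other \<open>I\<close> have the
        values \<open>y\<close>, \<open>x\<close> and \<open>x \<otimes> y\<close>.\<close>
      define \<gamma> where "\<gamma> v = (if v = p A then x else if v = p B then y else \<one>)" for v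
      have pAB: "p A \<noteq> p B" using two inj by (meson inj_onD)
      have val: "wprod G \<gamma> u = x [^] count_list u (p A) \<otimes> y [^] count_list u (p B)" for u
        unfolding \<gamma>_def using wprod_two_letters[OF x(1) y(1,2) pAB] .
      have xn: "x [^] n = \<one>" using x(1,2) by auto
      have xy: "x \<noteq> \<one>" using x(2,3) by auto
      have pw: "z [^] count_list u (p J) = z [^] (of_bool (J \<noteq> I) :: nat)"
        if "z \<in> carrier G" "z [^] n = \<one>" "I \<in> \<J>" "J \<in> \<J>" "content_cong n V I u" for z I J u
      proof -
        have "int n dvd defect V I u (p J)"
          using that(5) by (simp add: content_cong_def)
        also have "defect V I u (p J) = int (count_list u (p J)) - int (of_bool (J \<noteq> I))"
          using that(3,4) p pV by (auto simp: defect_def)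
        finally show ?thesis using that(1,2) pow_eq_mod by blast
      qed
      have "wprod G \<gamma> w = \<one>"
        using two(4,5) pow_eq_mod[OF x(1) xn, of "count_list w (p A)" 0]
          pow_eq_mod[OF y(1,3), of "count_list w (p B)" 0]
        by (simp add: val m_def)
      moreover have "wprod G \<gamma> u \<noteq> \<one>" if "I \<in> \<J>" "content_cong n V I u" for I u
        using pw[OF x(1) xn that(1) two(1) that(2)] pw[OF y(1,3) that(1) two(2) that(2)] two(3) xy x(1) y
        by (cases "I = A"; cases "I = B") (auto simp: val)
      moreover have "\<gamma> v \<in> carrier G" for v
        using x(1) y(1) by (simp add: \<gamma>_def)
      ultimately show ?thesis
        by (intro thesisI[of \<gamma>]) metis+
    qed
  qed
qed

end

section \<open>Groups with at least three elements\<close>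

lemma trm_val_word_trm_map:
  "w \<noteq> [] \<Longrightarrow> trm_val A \<phi> (word_trm (map f w)) = trm_val A (\<phi> \<circ> f) (word_trm w)"
  by (induction w) auto

text \<open>The letter \<open>c\<close> now occurs \<open>card I\<close> times, a multiple of
  \<open>n\<close>; the other letters of \<open>I\<close> disappear, and those of
  \<open>V - I\<close> occur once.\<close>

lemma content_cong_merge:
  assumes "finite V" "I \<subseteq> V" "c \<in> I" "n dvd card I"
  shows "content_cong n V I (map (\<lambda>v. if v \<in> I then c else v) (sorted_list_of_set V))"
  unfolding content_cong_def
proof
  fix v
  let ?f = "\<lambda>v. if v \<in> I then c else v"
  have "count_list (map ?f (sorted_list_of_set V)) v =
      length (filter (\<lambda>z. ?f z = v) (sorted_list_of_set V))"
    by (simp add: count_list_eq_length_filter filter_map comp_def eq_commute)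
  also have "\<dots> = card {z \<in> V. ?f z = v}"
    using assms(1) by (subst distinct_card[symmetric]) auto
  also have "{z \<in> V. ?f z = v} = (if v = c then I else if v \<in> I then {} else {v} \<inter> V)"
    using assms by auto
  finally have "count_list (map ?f (sorted_list_of_set V)) v =
      card (if v = c then I else if v \<in> I then {} else {v} \<inter> V)" .
  then show "int n dvd defect V I (map ?f (sorted_list_of_set V)) v"
    using assms by (auto simp: defect_def)
qed

lemma count_list_distinct: "distinct xs \<Longrightarrow> count_list xs v = of_bool (v \<in> set xs)"
  by (induction xs) auto

text \<open>A letter of \<open>I\<close> occurs once, where a multiple of \<open>n\<close> is
  required.\<close>

lemma not_content_cong_list:
  assumes "finite V" "I \<subseteq> V" "I \<noteq> {}" "n \<ge> 2"
  shows "\<not> content_cong n V I (sorted_list_of_set V)"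
proof
  assume c: "content_cong n V I (sorted_list_of_set V)"
  obtain v where "v \<in> I" using assms(3) by blast
  moreover have "count_list (sorted_list_of_set V) v = of_bool (v \<in> V)"
    using assms(1) by (simp add: count_list_distinct)
  ultimately have "defect V I (sorted_list_of_set V) v = 1"
    using assms(2) by (auto simp: defect_def)
  then have "int n dvd 1" using c unfolding content_cong_def by metis
  then show False using assms(4) by simp
qed

section \<open>A class of words preserved by deductions\<close>

context group
begin

text \<open>A single word of \<open>subst \<sigma> t\<close> uses only boundedly many words of each \<open>\<sigma> x\<close>. Replacing
  \<open>\<sigma> x\<close> by these leaves a bounded number of words of \<open>subst \<sigma> s\<close>, to which the separation
  hypothesis applies.\<close>

lemma identity_preserves:
  assumes sat: "satisfies (power_alg G) (s, t)"
    and bound: "words_bound (Suc (size t)) s \<le> q"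
    and sep: "\<And>U w. \<lbrakk>finite U; card U \<le> q; U \<subseteq> W; w \<notin> W\<rbrakk>
      \<Longrightarrow> \<exists>\<gamma>. (\<forall>v. \<gamma> v \<in> carrier G) \<and> wprod G \<gamma> w \<notin> wprod G \<gamma> ` U"
    and s: "\<And>w. w \<in> words (subst \<sigma> s) \<Longrightarrow> a @ w @ b \<in> W"
    and w: "w \<in> words (subst \<sigma> t)"
  shows "a @ w @ b \<in> W"
proof (rule ccontr)
  assume "a @ w @ b \<notin> W"
  obtain F where F: "\<And>x. F x \<subseteq> words (\<sigma> x)" "\<And>x. finite (F x)"
    "\<And>x. card (F x) \<le> Suc (size t)" "w \<in> wds F t"
    using w wds_select[of w "\<lambda>x. words (\<sigma> x)" t] by (metis wds_subst)
  define U where "U = (\<lambda>z. a @ z @ b) ` wds F s"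
  have fin: "finite (wds F s)" "card (wds F s) \<le> q"
    using card_wds[of F "Suc (size t)" s] F(2,3) bound by auto
  have "U \<subseteq> W"
    using wds_mono[of F "\<lambda>x. words (\<sigma> x)" s] F(1) s by (auto simp: U_def wds_subst)
  moreover have "finite U" "card U \<le> q"
    using fin card_image_le[OF fin(1), of "\<lambda>z. a @ z @ b"] by (auto simp: U_def)
  ultimately obtain \<gamma> where \<gamma>: "\<And>v. \<gamma> v \<in> carrier G"
    "wprod G \<gamma> (a @ w @ b) \<notin> wprod G \<gamma> ` U"
    using sep \<open>a @ w @ b \<notin> W\<close> by blast
  \<comment> \<open>Some \<open>F x\<close> may be empty; the empty set is an element of the
    algebra.\<close>
  have "\<forall>x. wprod G \<gamma> ` F x \<in> carrier (power_alg G)"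
    using wprod_closed[OF \<gamma>(1)] by (auto simp: power_alg_def)
  then have "trm_val (power_alg G) (\<lambda>x. wprod G \<gamma> ` F x) s =
      trm_val (power_alg G) (\<lambda>x. wprod G \<gamma> ` F x) t"
    using sat[unfolded satisfies_def, rule_format, of "\<lambda>x. wprod G \<gamma> ` F x"] by simp
  then have "wprod G \<gamma> ` wds F s = wprod G \<gamma> ` wds F t"
    by (simp add: trm_val_power_alg_image[OF \<gamma>(1)])
  then obtain z where "z \<in> wds F s" "wprod G \<gamma> w = wprod G \<gamma> z"
    using F(4) by (metis imageE imageI)
  then have "wprod G \<gamma> (a @ w @ b) = wprod G \<gamma> (a @ z @ b)"
    by (simp add: wprod_append[OF \<gamma>(1)])
  then show False
    using \<gamma>(2) \<open>z \<in> wds F s\<close> by (auto simp: U_def)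
qed

text \<open>Induction on the derivation. The contexts \<open>a\<close> and \<open>b\<close> serve
  the product rule, where a factor is replaced next to words of the other factor. Symmetry calls for
  an equivalence, so identities are used in both directions and both bounds enter.\<close>

lemma deducible_preserves:
  assumes sat: "\<forall>e\<in>E. satisfies (power_alg G) e"
    and bound: "\<And>s t. (s, t) \<in> E \<Longrightarrow>
      words_bound (Suc (size t)) s \<le> q \<and> words_bound (Suc (size s)) t \<le> q"
    and sep: "\<And>U w. \<lbrakk>finite U; card U \<le> q; U \<subseteq> W; w \<notin> W\<rbrakk>
      \<Longrightarrow> \<exists>\<gamma>. (\<forall>v. \<gamma> v \<in> carrier G) \<and> wprod G \<gamma> w \<notin> wprod G \<gamma> ` U"
    and "deducible E s t"
  shows "(\<forall>w\<in>words s. a @ w @ b \<in> W) \<longleftrightarrow> (\<forall>w\<in>words t. a @ w @ b \<in> W)"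
  using assms(4)
proof (induction arbitrary: a b)
  case (ax s t \<sigma>)
  then have st: "satisfies (power_alg G) (s, t)" "satisfies (power_alg G) (t, s)"
    using sat by (force simp: satisfies_def)+
  have "a @ w @ b \<in> W"
    if "\<forall>z\<in>words (subst \<sigma> s). a @ z @ b \<in> W" "w \<in> words (subst \<sigma> t)" for w
    by (rule identity_preserves[OF st(1) conjunct1[OF bound[OF ax]] sep]) (use that in auto)
  moreover have "a @ w @ b \<in> W"
    if "\<forall>z\<in>words (subst \<sigma> t). a @ z @ b \<in> W" "w \<in> words (subst \<sigma> s)" for w
    by (rule identity_preserves[OF st(2) conjunct2[OF bound[OF ax]] sep]) (use that in auto)
  ultimately show ?case by blast
next
  case (add s s' t t')
  then show ?case by (simp add: ball_Un)
next
  case (mul s s' t t')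
  \<comment> \<open>The left factor is replaced in the context \<open>a\<close>,
    \<open>v @ b\<close>, then the right one in the context \<open>a @ u\<close>,
    \<open>b\<close>.\<close>
  have "(\<forall>w\<in>words (Mul s t). a @ w @ b \<in> W) \<longleftrightarrow>
      (\<forall>v\<in>words t. \<forall>u\<in>words s. a @ u @ (v @ b) \<in> W)"
    by fastforce
  also have "\<dots> \<longleftrightarrow> (\<forall>v\<in>words t. \<forall>u\<in>words s'. a @ u @ (v @ b) \<in> W)"
    using mul.IH(1) by simp
  also have "\<dots> \<longleftrightarrow> (\<forall>u\<in>words s'. \<forall>v\<in>words t. (a @ u) @ v @ b \<in> W)"
    by auto
  also have "\<dots> \<longleftrightarrow> (\<forall>u\<in>words s'. \<forall>v\<in>words t'. (a @ u) @ v @ b \<in> W)"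
    by (simp only: mul.IH(2))
  also have "\<dots> \<longleftrightarrow> (\<forall>w\<in>words (Mul s' t'). a @ w @ b \<in> W)"
    by fastforce
  finally show ?case .
qed auto

text \<open>If some \<open>x\<close> has a nontrivial square, \<open>y = x\<close> works. Otherwise
  all elements are their own inverses, the group is commutative, and any two distinct nontrivial
  elements will do.\<close>

lemma commuting_pair:
  assumes "finite (carrier G)" "3 \<le> order G"
  obtains x y where "x \<in> carrier G" "y \<in> carrier G" "x \<otimes> y = y \<otimes> x" "2 \<le> ord x"
    "y [^] ord x = \<one>" "y \<noteq> \<one>" "x \<otimes> y \<noteq> \<one>"
proof -
  have ord2: "2 \<le> ord x" if "x \<in> carrier G" "x \<noteq> \<one>" for x
    using that ord_ge_1[OF assms(1) that(1)] ord_eq_1[OF that(1)] by linarith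
  show ?thesis
  proof (cases "\<exists>x\<in>carrier G. x \<otimes> x \<noteq> \<one>")
    case True
    then obtain x where x: "x \<in> carrier G" "x \<otimes> x \<noteq> \<one>" by blast
    then have "x \<noteq> \<one>" by auto
    then show ?thesis using x ord2 by (intro that[of x x]) auto
  next
    case False
    then have inv2: "z \<otimes> z = \<one>" if "z \<in> carrier G" for z using that by blast
    have "card {\<one>} < card (carrier G)" using assms(2) by (simp add: order_def)
    then obtain x where x: "x \<in> carrier G" "x \<noteq> \<one>"
      by (metis card_mono finite.emptyI finite_insert insertI1 linorder_not_less subsetI)
    have "card {\<one>, x} < card (carrier G)" using assms(2) x by (simp add: order_def)
    then obtain y where y: "y \<in> carrier G" "y \<noteq> \<one>" "y \<noteq> x"
      by (metis card_mono finite.emptyI finite_insert insertCI linorder_not_less subsetI)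
    have inv: "inv z = z" if "z \<in> carrier G" for z
      using inv2[OF that] that by (simp add: inv_equality)
    have comm: "x \<otimes> y = y \<otimes> x"
      using inv[of "x \<otimes> y"] inv[OF x(1)] inv[OF y(1)] x(1) y(1) by (simp add: inv_mult_group)
    have "x \<otimes> y \<noteq> \<one>"
      using inv_equality[of y x] comm x(1) y inv[OF x(1)] by metis
    moreover have "ord x = 2"
    proof -
      have "x [^] (2::nat) = \<one>" using inv2 x(1) by (simp add: numeral_2_eq_2)
      then have "ord x dvd 2" using pow_eq_id[OF x(1)] by simp
      then show ?thesis using ord2[OF x] by (simp add: dvd_imp_le le_antisym)
    qed
    ultimately show ?thesis
      using x y comm inv2[OF y(1)] by (intro that[of x y]) (auto simp: numeral_2_eq_2)
  qed
qed

text \<open>The invariant class \<open>W\<close> contains all words of the sum \<open>u\<close> of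
  merged products, but not the full product \<open>w\<close>. The valid inequality
  \<open>w \<le> u\<close> would be deducible and force \<open>w\<close> into
  \<open>W\<close>.\<close>

lemma not_finitely_based_power_alg:
  assumes "finite (carrier G)" "3 \<le> order G"
  shows "\<not> finitely_based (power_alg G)"
proof
  assume "finitely_based (power_alg G)"
  then obtain E where E: "finite E" "\<forall>e\<in>E. satisfies (power_alg G) e"
    "\<And>s t. satisfies (power_alg G) (s, t) \<Longrightarrow> deducible E s t"
    unfolding finitely_based_def by blast
  define q where "q = (\<Sum>(s, t)\<in>E. words_bound (Suc (size t)) s + words_bound (Suc (size s)) t)"
  have bound: "words_bound (Suc (size t)) s \<le> q \<and> words_bound (Suc (size s)) t \<le> q"
    if "(s, t) \<in> E" for s t
    using member_le_sum[OF that, of "\<lambda>(s, t). words_bound (Suc (size t)) s + words_bound (Suc (size s)) t"]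
      E(1) by (simp add: q_def)
  obtain x y where xy: "x \<in> carrier G" "y \<in> carrier G" "x \<otimes> y = y \<otimes> x" "2 \<le> ord x"
    "y [^] ord x = \<one>" "y \<noteq> \<one>" "x \<otimes> y \<noteq> \<one>"
    using commuting_pair[OF assms] by blast
  define n where "n = ord x"
  \<comment> \<open>An assignment colours the variables by subsets of \<open>G\<close>.\<close>
  define C where "C = card (Pow (carrier G))"
  obtain V :: "nat set" and \<I> where V: "finite V" "\<And>I. I \<in> \<I> \<Longrightarrow> I \<subseteq> V"
    and \<I>: "\<And>I. I \<in> \<I> \<Longrightarrow> I \<noteq> {} \<and> n dvd card I"
    and priv: "\<And>\<J> I. \<lbrakk>\<J> \<subseteq> \<I>; card \<J> \<le> q; I \<in> \<J>\<rbrakk> \<Longrightarrow> \<exists>v\<in>I. \<forall>I'\<in>\<J>. v \<in> I' \<longrightarrow> I' = I"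
    and mono: "\<And>f. f ` V \<subseteq> {..<C} \<Longrightarrow> \<exists>I\<in>\<I>. \<exists>c. \<forall>v\<in>I. f v = c"
  proof -
    have "n > 0" using xy(4) by (simp add: n_def)
    then show ?thesis by (rule ramsey_family_with_private_elements[of n q C]) (rule that)
  qed
  \<comment> \<open>A constant colouring shows that the family is nonempty; the sum \<open>u\<close>
    needs a summand.\<close>
  have "C > 0" using assms(1) by (simp add: C_def card_Pow)
  then obtain I0 where I0: "I0 \<in> \<I>" using mono[of "\<lambda>_. 0"] by auto
  define W where "W = {w. \<exists>I\<in>\<I>. content_cong n V I w}"
  have sep: "\<exists>\<gamma>. (\<forall>v. \<gamma> v \<in> carrier G) \<and> wprod G \<gamma> w \<notin> wprod G \<gamma> ` U"
    if U: "finite U" "card U \<le> q" "U \<subseteq> W" "w \<notin> W" for U w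
  proof -
    have "\<forall>u\<in>U. \<exists>I. I \<in> \<I> \<and> content_cong n V I u" using U(3) by (auto simp: W_def)
    then obtain J where J: "\<And>u. u \<in> U \<Longrightarrow> J u \<in> \<I> \<and> content_cong n V (J u) u" by metis
    have "J ` U \<subseteq> \<I>" using J by blast
    \<comment> \<open>At most \<open>q\<close> words involve at most \<open>q\<close> sets of the
      family, and among these private elements exist.\<close>
    have "card (J ` U) \<le> q" using card_image_le[OF U(1), of J] U(2) by simp
    obtain \<gamma> where "\<And>v. \<gamma> v \<in> carrier G"
      "\<And>I u. \<lbrakk>I \<in> J ` U; content_cong n V I u\<rbrakk> \<Longrightarrow> wprod G \<gamma> w \<noteq> wprod G \<gamma> u"
    proof (rule separating_assignment[of x n y "J ` U" V w])
      show "\<exists>v\<in>I. \<forall>I'\<in>J ` U. v \<in> I' \<longrightarrow> I' = I" if "I \<in> J ` U" for I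
        using priv \<open>J ` U \<subseteq> \<I>\<close> \<open>card (J ` U) \<le> q\<close> that by blast
      show "I \<subseteq> V" "\<not> content_cong n V I w" if "I \<in> J ` U" for I
        using that J V(2) U(4) by (auto simp: W_def)
    qed (use xy U(1) in \<open>auto simp: n_def\<close>)
    then show ?thesis using J by blast
  qed
  define w where "w = sorted_list_of_set V"
  define mrg where "mrg I = map (\<lambda>v. if v \<in> I then Min I else v) w" for I
  have "w \<noteq> []" using V I0 \<I>[OF I0] by (auto simp: w_def)
  have fI: "finite \<I>" using V by (meson Pow_iff finite_Pow_iff finite_subset subsetI)
  obtain u where u: "words u = mrg ` \<I>"
    using trm_of_words[of "mrg ` \<I>"] fI I0 \<open>w \<noteq> []\<close> by (auto simp: mrg_def)
  have "satisfies (power_alg G) (Add (word_trm w) u, u)"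
    unfolding satisfies_def
  proof (intro allI impI)
    fix \<phi> :: "nat \<Rightarrow> 'a set" assume "\<forall>x. \<phi> x \<in> carrier (power_alg G)"
    then have \<phi>: "\<And>x. \<phi> x \<subseteq> carrier G" by (simp add: power_alg_def)
    obtain h where h: "bij_betw h (Pow (carrier G)) {0..<C}"
      using ex_bij_betw_finite_nat[of "Pow (carrier G)"] assms(1) by (auto simp: C_def)
    then have "(h \<circ> \<phi>) ` V \<subseteq> {..<C}"
      using \<phi> by (fastforce simp: bij_betw_def)
    \<comment> \<open>The assignment is constant on this \<open>I\<close>, so merging
      \<open>I\<close> leaves the value of the product unchanged.\<close>
    then obtain I c where I: "I \<in> \<I>" "\<And>v. v \<in> I \<Longrightarrow> h (\<phi> v) = c"
      using mono by fastforce
    have "Min I \<in> I" using I(1) \<I> V finite_subset by (metis Min_in)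
    then have "\<phi> v = \<phi> (Min I)" if "v \<in> I" for v
      using I(2) that h \<phi> by (metis PowI bij_betw_def inj_onD)
    then have "\<phi> \<circ> (\<lambda>v. if v \<in> I then Min I else v) = \<phi>" by (auto simp: fun_eq_iff)
    then have "trm_val (power_alg G) \<phi> (word_trm w) = trm_val (power_alg G) \<phi> (word_trm (mrg I))"
      using trm_val_word_trm_map[OF \<open>w \<noteq> []\<close>, of "power_alg G" \<phi> "\<lambda>v. if v \<in> I then Min I else v"]
      by (simp add: mrg_def)
    also have "\<dots> \<subseteq> trm_val (power_alg G) \<phi> u"
      using trm_val_power_alg_words[of \<phi> u, OF \<phi>] I(1) by (auto simp: u)
    finally show "trm_val (power_alg G) \<phi> (fst (Add (word_trm w) u, u)) =
        trm_val (power_alg G) \<phi> (snd (Add (word_trm w) u, u))"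
      by (auto simp: power_alg_def)
  qed
  then have ded: "deducible E (Add (word_trm w) u) u" by (rule E(3))
  have "mrg I \<in> W" if I: "I \<in> \<I>" for I
  proof -
    have "Min I \<in> I" using V(2)[OF I] \<I>[OF I] V(1) finite_subset by (metis Min_in)
    then have "content_cong n V I (mrg I)"
      using content_cong_merge[OF V(1) V(2)[OF I]] \<I>[OF I] by (simp add: mrg_def w_def)
    then show ?thesis using I by (auto simp: W_def)
  qed
  then have "\<forall>z\<in>words u. [] @ z @ [] \<in> W" by (simp add: u)
  then have "\<forall>z\<in>words (Add (word_trm w) u). [] @ z @ [] \<in> W"
    using deducible_preserves[OF E(2) bound sep ded] by blast
  then have "w \<in> W" using words_word_trm[OF \<open>w \<noteq> []\<close>] by simp
  then show False
    using not_content_cong_list[OF V(1), of _ n] V(2) \<I> xy(4) by (auto simp: W_def w_def n_def)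
qed

end

section \<open>Groups with at most two elements\<close>

text \<open>Concatenations of an odd number of words of \<open>W\<close>. Modulo two, their contents
  form the affine span of the contents of \<open>W\<close>.\<close>

inductive_set odd_concats :: "nat list set \<Rightarrow> nat list set" for W where
  base: "w \<in> W \<Longrightarrow> w \<in> odd_concats W"
| step: "\<lbrakk>u \<in> odd_concats W; v \<in> odd_concats W; w \<in> odd_concats W\<rbrakk>
    \<Longrightarrow> u @ v @ w \<in> odd_concats W"

text \<open>Modulo two, the linear functional on contents given by the indicator function of
  \<open>T\<close>.\<close>

definition count_in :: "nat set \<Rightarrow> nat list \<Rightarrow> nat" where
  "count_in T w = length (filter (\<lambda>x. x \<in> T) w)"

lemma count_in_append [simp]: "count_in T (u @ v) = count_in T u + count_in T v"
  by (simp add: count_in_def)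

lemma count_in_insert: "x \<notin> T \<Longrightarrow> count_in (insert x T) w = count_in T w + count_list w x"
  by (induction w) (auto simp: count_in_def)

lemma count_in_empty [simp]: "count_in {} w = 0"
  by (simp add: count_in_def)

text \<open>Modulo two, a point outside an affine subspace is separated from it by a linear functional.\<close>

lemma parity_separation:
  assumes "finite S" "\<And>a b c. \<lbrakk>a \<in> C; b \<in> C; c \<in> C\<rbrakk> \<Longrightarrow> a @ b @ c \<in> C"
  shows "(\<exists>c\<in>C. \<forall>x\<in>S. even (count_list c x + count_list w x)) \<or>
    (\<exists>T\<subseteq>S. \<forall>c\<in>C. odd (count_in T c + count_in T w))"
  using assms
proof (induction S arbitrary: C rule: finite_induct)
  case empty
  then show ?case by auto
next
  case (insert x S)
  \<comment> \<open>The part of \<open>C\<close> that agrees with \<open>w\<close> at the new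
    coordinate.\<close>
  define D where "D = {c \<in> C. even (count_list c x + count_list w x)}"
  have "a @ b @ c \<in> D" if "a \<in> D" "b \<in> D" "c \<in> D" for a b c
    using that insert.prems by (auto simp: D_def)
  from insert.IH[OF this] show ?case
  proof
    assume "\<exists>c\<in>D. \<forall>x\<in>S. even (count_list c x + count_list w x)"
    then show ?thesis by (auto simp: D_def)
  next
    assume "\<exists>T\<subseteq>S. \<forall>c\<in>D. odd (count_in T c + count_in T w)"
    then obtain T where T: "T \<subseteq> S" "\<And>c. c \<in> D \<Longrightarrow> odd (count_in T c + count_in T w)" by blast
    have xT: "x \<notin> T" using T(1) insert.hyps(2) by blast
    show ?thesis
    proof (cases "D = {}")
      case True
      then have "\<forall>c\<in>C. odd (count_in {x} c + count_in {x} w)"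
        using count_in_insert[of x "{}"] by (auto simp: D_def)
      then show ?thesis by blast
    next
      case False
      then obtain d where d: "d \<in> D" by blast
      have const: "even (count_in T a + count_in T b)" if "a \<in> C - D" "b \<in> C - D" for a b
      proof -
        \<comment> \<open>Both \<open>a\<close> and \<open>b\<close> are wrong at \<open>x\<close>,
          and the two errors cancel.\<close>
        have "a @ b @ d \<in> D" using that d insert.prems by (auto simp: D_def)
        then show ?thesis using T(2)[OF d] T(2)[of "a @ b @ d"] by auto
      qed
      show ?thesis
      proof (cases "\<exists>c\<in>C - D. even (count_in T c + count_in T w)")
        case True
        then obtain e where e: "e \<in> C - D" "even (count_in T e + count_in T w)" by blast
        \<comment> \<open>By \<open>const\<close>, the functional of \<open>T\<close> fails on all
          of \<open>C - D\<close> once it fails at \<open>e\<close>. Adding \<open>x\<close> to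
          \<open>T\<close> flips the parity exactly on \<open>C - D\<close>.\<close>
        have "odd (count_in (insert x T) c + count_in (insert x T) w)" if "c \<in> C" for c
        proof (cases "c \<in> D")
          case True
          then show ?thesis using T(2)[OF True] by (auto simp: count_in_insert[OF xT] D_def)
        next
          case False
          then have "even (count_in T c + count_in T w)" using e const[of c e] that by auto
          then show ?thesis using False that by (auto simp: count_in_insert[OF xT] D_def)
        qed
        then show ?thesis using T(1) by blast
      next
        case False
        then show ?thesis using T by blast
      qed
    qed
  qed
qed

text \<open>An empty language at a variable deletes all words in which the variable occurs.\<close>

lemma wds_restrict: "wds (\<lambda>x. if x \<in> S then {[x]} else {}) t = {u \<in> words t. set u \<subseteq> S}"
  by (induction t) (auto, fastforce)

lemma even_counts_double:
  assumes "\<And>x. even (count_list w x)"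
  obtains m where "mset w = mset (m @ m)" "set m = set w"
proof -
  have "\<exists>m. mset w = mset (m @ m)"
    using assms
  proof (induction w rule: length_induct)
    case (1 w)
    show ?case
    proof (cases w)
      case (Cons x w')
      then have "odd (count_list w' x)" using 1(2)[of x] by simp
      then have "x \<in> set w'" by (metis count_notin even_zero)
      then obtain a b where ab: "w' = a @ x # b" by (meson split_list)
      have "even (count_list (a @ b) z)" for z
        using 1(2)[of z] by (simp add: Cons ab split: if_splits)
      moreover have "length (a @ b) < length w" by (simp add: Cons ab)
      ultimately obtain m where "mset (a @ b) = mset (m @ m)"
        using 1(1) by blast
      then have "mset w = mset ((x # m) @ x # m)" by (simp add: Cons ab)
      then show ?thesis by blast
    qed simp
  qed
  then show ?thesis using that by (metis mset_eq_setD set_append sup.idem)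
qed

section \<open>Consequences of a valid inequality in a group with an involution\<close>

context group
begin

lemma trm_val_word_trm_empty:
  "\<lbrakk>x \<in> set w; \<phi> x = {}\<rbrakk> \<Longrightarrow> trm_val (power_alg G) \<phi> (word_trm w) = {}"
  by (induction w) (auto simp: power_alg_def set_mult_def)

lemma trm_val_word_trm_one:
  "\<lbrakk>w \<noteq> []; \<And>x. x \<in> set w \<Longrightarrow> \<phi> x = {\<one>}\<rbrakk>
    \<Longrightarrow> trm_val (power_alg G) \<phi> (word_trm w) = {\<one>}"
  by (induction w) (auto simp: power_alg_def set_mult_def)

lemma carrier_mult: "carrier G <#> carrier G = carrier G"
  by (auto simp: set_mult_def intro: bexI[of _ \<one>])

lemma trm_val_word_trm_carrier:
  assumes "\<And>x. x \<in> set w \<Longrightarrow> \<phi> x = {\<one>} \<or> \<phi> x = carrier G"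
    and "\<exists>y\<in>set w. \<phi> y = carrier G"
  shows "trm_val (power_alg G) \<phi> (word_trm w) = carrier G"
  using assms
proof (induction w)
  case (Cons z w)
  let ?v = "trm_val (power_alg G) \<phi> (word_trm w)"
  show ?case
  proof (cases "w = []")
    case False
    have "trm_val (power_alg G) \<phi> (word_trm (z # w)) = \<phi> z <#> ?v"
      using False by (simp add: power_alg_def)
    moreover have "carrier G <#> {\<one>} = carrier G" "{\<one>} <#> carrier G = carrier G"
      by (auto simp: set_mult_def)
    moreover have "\<phi> z = {\<one>} \<or> \<phi> z = carrier G" using Cons.prems(1) by simp
    moreover have "?v = carrier G" if "\<exists>y\<in>set w. \<phi> y = carrier G"
      using that Cons.IH Cons.prems(1) by simp
    moreover have "?v = {\<one>} \<and> \<phi> z = carrier G" if "\<not> (\<exists>y\<in>set w. \<phi> y = carrier G)"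
      using that Cons.prems False by (auto intro!: trm_val_word_trm_one)
    ultimately show ?thesis
      using carrier_mult by metis
  qed (use Cons.prems in auto)
qed simp

lemma wprod_involution:
  assumes "g \<in> carrier G" "g \<otimes> g = \<one>"
  shows "wprod G (\<lambda>x. if x \<in> T then g else \<one>) w = (if odd (count_in T w) then g else \<one>)"
  using assms by (induction w) (auto simp: count_in_def)

text \<open>Assignments that are empty outside \<open>w\<close> leave only words with letters of
  \<open>w\<close>. The values \<open>{\<one>}\<close> and \<open>{g}\<close> rule out every
  separating parity functional, which gives a word with the right parities. Each letter of
  \<open>w\<close> occurs in some remaining word of \<open>t\<close>; appending that word twice adds
  the letter and keeps the parities.\<close>

lemma covering_word_of_inequality:
  assumes g: "g \<in> carrier G" "g \<noteq> \<one>" "g \<otimes> g = \<one>"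
    and w: "w \<noteq> []"
    and le: "\<And>\<phi>. (\<And>x. \<phi> x \<subseteq> carrier G) \<Longrightarrow>
      trm_val (power_alg G) \<phi> (word_trm w) \<subseteq> trm_val (power_alg G) \<phi> t"
  obtains c where "c \<in> odd_concats (words t)" "set c = set w"
    "\<And>x. even (count_list c x + count_list w x)"
proof -
  define W where "W = {u \<in> words t. set u \<subseteq> set w}"
  define C where "C = odd_concats W"
  have Cset: "set c \<subseteq> set w \<and> c \<in> odd_concats (words t)" if "c \<in> C" for c
    using that unfolding C_def
    by (induction rule: odd_concats.induct) (auto simp: W_def intro: odd_concats.intros)
  have Cstep: "a @ b @ c \<in> C" if "a \<in> C" "b \<in> C" "c \<in> C" for a b c
    using that unfolding C_def by (rule odd_concats.step)
  have "\<not> (\<forall>c\<in>C. odd (count_in T c + count_in T w))" for T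
  proof -
    let ?\<gamma> = "\<lambda>x. if x \<in> T then g else \<one>"
    let ?F = "\<lambda>x. if x \<in> set w then {[x]} else {}"
    have \<gamma>: "?\<gamma> x \<in> carrier G" for x using g(1) by simp
    have "wprod G ?\<gamma> ` wds ?F (word_trm w) \<subseteq> wprod G ?\<gamma> ` wds ?F t"
      using le[of "\<lambda>x. wprod G ?\<gamma> ` ?F x"] wprod_closed[of ?\<gamma>] \<gamma>
      by (simp only: trm_val_power_alg_image[OF \<gamma>]) blast
    then have "wprod G ?\<gamma> w \<in> wprod G ?\<gamma> ` W"
      using words_word_trm[OF w] by (auto simp: wds_restrict W_def)
    then obtain u where "u \<in> W" "even (count_in T u + count_in T w)"
      using g(2) by (auto simp: wprod_involution[OF g(1,3)] split: if_splits)
    then show ?thesis using odd_concats.base[of u W] by (auto simp: C_def)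
  qed
  then obtain c0 where c0: "c0 \<in> C" "\<And>x. x \<in> set w \<Longrightarrow> even (count_list c0 x + count_list w x)"
    using parity_separation[of "set w" C w, OF finite_set Cstep] by blast
  have cover: "\<exists>u\<in>W. y \<in> set u" if y: "y \<in> set w" for y
  proof (rule ccontr)
    assume no: "\<not> (\<exists>u\<in>W. y \<in> set u)"
    \<comment> \<open>The word \<open>w\<close> gets the value \<open>carrier G\<close>, while a
      word of \<open>t\<close> that avoids \<open>y\<close> or leaves the letters of
      \<open>w\<close> gets at most \<open>{\<one>}\<close>.\<close>
    define \<phi> where "\<phi> x = (if x = y then carrier G else if x \<in> set w then {\<one>} else {})" for x
    have \<phi>: "\<phi> x \<subseteq> carrier G" for x by (auto simp: \<phi>_def)
    have "trm_val (power_alg G) \<phi> (word_trm u) \<subseteq> {\<one>}" if "u \<in> words t" for u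
    proof (cases "set u \<subseteq> set w")
      case True
      then have "y \<notin> set u" using no that by (auto simp: W_def)
      then show ?thesis
        using True by (subst trm_val_word_trm_one[OF words_nonempty[OF that]]) (auto simp: \<phi>_def)
    next
      case False
      then obtain x where "x \<in> set u" "x \<notin> set w" by blast
      moreover from this have "\<phi> x = {}" using y by (auto simp: \<phi>_def)
      ultimately show ?thesis
        using trm_val_word_trm_empty[of x u \<phi>] by simp
    qed
    then have "trm_val (power_alg G) \<phi> t \<subseteq> {\<one>}"
      using trm_val_power_alg_words[of \<phi> t, OF \<phi>] by blast
    moreover have "trm_val (power_alg G) \<phi> (word_trm w) = carrier G"
      using y by (intro trm_val_word_trm_carrier[of w \<phi>]) (auto simp: \<phi>_def)
    ultimately show False using le[of \<phi>, OF \<phi>] g(1,2) by blast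
  qed
  have "\<exists>c\<in>C. Y \<subseteq> set c \<and> (\<forall>x\<in>set w. even (count_list c x + count_list w x))"
    if "finite Y" "Y \<subseteq> set w" for Y
    using that
  proof (induction Y rule: finite_induct)
    case empty
    then show ?case using c0 by blast
  next
    case (insert y Y)
    then obtain c where c: "c \<in> C" "Y \<subseteq> set c"
      "\<forall>x\<in>set w. even (count_list c x + count_list w x)" by auto
    obtain u where u: "u \<in> W" "y \<in> set u" using cover insert.prems by blast
    have "c @ u @ u \<in> C" using Cstep c(1) u(1) odd_concats.base[of u W] by (auto simp: C_def)
    moreover have "insert y Y \<subseteq> set (c @ u @ u)" using c(2) u(2) by auto
    moreover have "\<forall>x\<in>set w. even (count_list (c @ u @ u) x + count_list w x)" using c(3) by auto
    ultimately show ?case by blast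
  qed
  from this[of "set w"] obtain c where c: "c \<in> C" "set w \<subseteq> set c"
    "\<forall>x\<in>set w. even (count_list c x + count_list w x)" by auto
  have "even (count_list c x + count_list w x)" for x
  proof (cases "x \<in> set w")
    case False
    then have "x \<notin> set c" using Cset[OF c(1)] by blast
    then show ?thesis using False by (simp add: count_notin)
  qed (use c(3) in simp)
  then show ?thesis using that[of c] c Cset[OF c(1)] by auto
qed

end

section \<open>Inequalities that follow from the ternary law\<close>

locale ternary_ai_semiring = ai_semiring +
  assumes mul_comm: "\<lbrakk>x \<in> carrier A; y \<in> carrier A\<rbrakk> \<Longrightarrow> smul A x y = smul A y x"
    and cube: "x \<in> carrier A \<Longrightarrow> smul A x (smul A x x) = x"
    and ternary: "\<lbrakk>x \<in> carrier A; y \<in> carrier A; z \<in> carrier A\<rbrakk> \<Longrightarrow>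
      sadd A (smul A x (smul A y z)) (sadd A x (sadd A y z)) = sadd A x (sadd A y z)"

locale ternary_valuation = ternary_ai_semiring +
  fixes \<phi> :: "nat \<Rightarrow> 'a"
  assumes valuation_closed: "\<phi> x \<in> carrier A"
begin

abbreviation val :: "trm \<Rightarrow> 'a" where
  "val \<equiv> trm_val A \<phi>"

abbreviation wval :: "nat list \<Rightarrow> 'a" where
  "wval w \<equiv> val (word_trm w)"

definition le :: "'a \<Rightarrow> 'a \<Rightarrow> bool" where
  "le x y \<longleftrightarrow> sadd A x y = y"

lemma val_closed [simp]: "val t \<in> carrier A"
  by (rule trm_val_closed) (rule valuation_closed)

declare valuation_closed [simp] add_closed [simp] mul_closed [simp]

lemma wval_append: "\<lbrakk>u \<noteq> []; v \<noteq> []\<rbrakk> \<Longrightarrow> wval (u @ v) = smul A (wval u) (wval v)"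
  by (rule trm_val_word_trm_append) simp_all

lemma le_trans:
  "\<lbrakk>x \<in> carrier A; y \<in> carrier A; z \<in> carrier A; le x y; le y z\<rbrakk> \<Longrightarrow> le x z"
  unfolding le_def by (metis add_assoc)

lemma le_antisym: "\<lbrakk>x \<in> carrier A; y \<in> carrier A; le x y; le y x\<rbrakk> \<Longrightarrow> x = y"
  unfolding le_def by (metis add_comm)

lemma add_least:
  "\<lbrakk>x \<in> carrier A; y \<in> carrier A; z \<in> carrier A; le x z; le y z\<rbrakk> \<Longrightarrow> le (sadd A x y) z"
  unfolding le_def by (metis add_assoc)

lemma le_add1: "\<lbrakk>x \<in> carrier A; y \<in> carrier A\<rbrakk> \<Longrightarrow> le x (sadd A x y)"
  unfolding le_def by (metis add_assoc add_idem)

lemma le_add2: "\<lbrakk>x \<in> carrier A; y \<in> carrier A\<rbrakk> \<Longrightarrow> le y (sadd A x y)"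
  by (metis le_add1 add_comm)

lemma mul_mono:
  assumes "x \<in> carrier A" "x' \<in> carrier A" "y \<in> carrier A" "y' \<in> carrier A" "le x x'" "le y y'"
  shows "le (smul A x y) (smul A x' y')"
proof (rule le_trans[of _ "smul A x' y"])
  show "le (smul A x y) (smul A x' y)"
    using assms unfolding le_def by (metis distrib_right)
  show "le (smul A x' y) (smul A x' y')"
    using assms unfolding le_def by (metis distrib_left)
qed (use assms in auto)

lemma mul_left_comm:
  assumes "x \<in> carrier A" "y \<in> carrier A" "z \<in> carrier A"
  shows "smul A x (smul A y z) = smul A y (smul A x z)"
  using assms mul_assoc mul_comm by metis

lemma wval_le_val: "w \<in> words t \<Longrightarrow> le (wval w) (val t)"
proof (induction t arbitrary: w)
  case (Var x)
  then show ?case by (simp add: le_def add_idem)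
next
  case (Add s t)
  then consider "w \<in> words s" | "w \<in> words t" by auto
  then show ?case
  proof cases
    case 1
    then show ?thesis using Add.IH(1) le_add1 le_trans[of "wval w" "val s"] by simp
  next
    case 2
    then show ?thesis using Add.IH(2) le_add2 le_trans[of "wval w" "val t"] by simp
  qed
next
  case (Mul s t)
  then obtain u v where uv: "u \<in> words s" "v \<in> words t" "w = u @ v" by auto
  then have "u \<noteq> []" "v \<noteq> []" using words_nonempty by blast+
  then show ?case
    using uv Mul.IH by (simp add: wval_append mul_mono)
qed

text \<open>The extra factor \<open>c\<close> collects the other factors of a product during the
  induction; by commutativity one side is enough.\<close>

lemma val_mul_le:
  assumes "c \<in> carrier A" "z \<in> carrier A"
    and "\<And>w. w \<in> words t \<Longrightarrow> le (smul A (wval w) c) z"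
  shows "le (smul A (val t) c) z"
  using assms
proof (induction t arbitrary: c)
  case (Add s t)
  then show ?case
    by (simp add: distrib_right add_least)
next
  case (Mul s t)
  have "le (smul A (val s) (smul A (val t) c)) z"
  proof (rule Mul.IH(1))
    fix u assume u: "u \<in> words s"
    have "le (smul A (val t) (smul A (wval u) c)) z"
    proof (rule Mul.IH(2))
      fix v assume v: "v \<in> words t"
      have "le (smul A (wval (u @ v)) c) z"
        using Mul.prems(3)[of "u @ v"] u v by auto
      moreover have "u \<noteq> []" "v \<noteq> []" using u v words_nonempty by blast+
      ultimately show "le (smul A (wval v) (smul A (wval u) c)) z"
        using Mul.prems(1) mul_left_comm[of "wval v" "wval u" c] by (simp add: wval_append mul_assoc)
    qed (use Mul.prems in auto)
    then show "le (smul A (wval u) (smul A (val t) c)) z"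
      using Mul.prems(1) mul_left_comm[of "val t" "wval u" c] by simp
  qed (use Mul.prems in auto)
  then show ?case using Mul.prems(1) by (simp add: mul_assoc)
qed simp

text \<open>No unit is available as \<open>c\<close> in \<open>val_mul_le\<close>, so the product
  case expands one factor after the other.\<close>

lemma val_le:
  assumes "z \<in> carrier A" "\<And>w. w \<in> words t \<Longrightarrow> le (wval w) z"
  shows "le (val t) z"
  using assms(2)
proof (induction t)
  case (Add s t)
  then show ?case using assms(1) by (simp add: add_least)
next
  case (Mul s t)
  have "le (smul A (val s) (val t)) z"
  proof (rule val_mul_le)
    fix u assume u: "u \<in> words s"
    have "le (smul A (val t) (wval u)) z"
    proof (rule val_mul_le)
      fix v assume v: "v \<in> words t"
      have "le (wval (u @ v)) z" using Mul.prems u v by auto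
      moreover have "u \<noteq> []" "v \<noteq> []" using u v words_nonempty by blast+
      ultimately show "le (smul A (wval v) (wval u)) z"
        using mul_comm[of "wval v" "wval u"] by (simp add: wval_append)
    qed (use assms(1) in auto)
    then show "le (smul A (wval u) (val t)) z"
      using mul_comm[of "wval u" "val t"] by simp
  qed (use assms(1) in auto)
  then show ?case by simp
qed simp

lemma wval_middle:
  assumes "u @ v \<noteq> []"
  shows "wval (u @ x # v) = smul A (\<phi> x) (wval (u @ v))"
  using assms
proof (induction u)
  case (Cons y u)
  then show ?case
  proof (cases "u @ v = []")
    case True
    then show ?thesis using Cons.prems mul_comm[of "\<phi> y" "\<phi> x"] by simp
  next
    case False
    then show ?thesis
      using Cons.IH mul_left_comm[of "\<phi> y" "\<phi> x" "wval (u @ v)"] by auto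
  qed
qed simp

lemma wval_perm: "mset u = mset v \<Longrightarrow> wval u = wval v"
proof (induction u arbitrary: v)
  case (Cons x u)
  then have "x \<in> set v" by (metis list.set_intros(1) mset_eq_setD)
  then obtain a b where v: "v = a @ x # b" by (meson split_list)
  then have m: "mset u = mset (a @ b)" using Cons.prems by simp
  show ?case
  proof (cases "u = []")
    case False
    then have "a @ b \<noteq> []" using m by auto
    then show ?thesis
      using Cons.IH[OF m] False v wval_middle by simp
  qed (use m v in simp)
qed simp

lemma wval_absorb_square:
  assumes "x \<in> set w"
  shows "wval (x # x # w) = wval w"
proof -
  obtain a b where w: "w = a @ x # b" using assms by (meson split_list)
  show ?thesis
  proof (cases "a @ b = []")
    case True
    then show ?thesis using cube w by simp
  next
    case False
    have "wval (x # x # w) = smul A (\<phi> x) (smul A (\<phi> x) (smul A (\<phi> x) (wval (a @ b))))"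
      using w wval_middle[OF False] by simp
    also have "\<dots> = smul A (smul A (\<phi> x) (smul A (\<phi> x) (\<phi> x))) (wval (a @ b))"
      by (simp add: mul_assoc)
    also have "\<dots> = wval w"
      using cube w wval_middle[OF False] by simp
    finally show ?thesis .
  qed
qed

lemma wval_absorb_double:
  assumes "set m \<subseteq> set w"
  shows "wval (m @ m @ w) = wval w"
  using assms
proof (induction m)
  case (Cons x m)
  have "wval ((x # m) @ (x # m) @ w) = wval (x # x # m @ m @ w)"
    by (rule wval_perm) simp
  also have "\<dots> = wval (m @ m @ w)"
    using Cons.prems by (intro wval_absorb_square) simp
  also have "\<dots> = wval w"
    using Cons by simp
  finally show ?case .
qed simp

text \<open>Both words equal a common multiple: \<open>v @ v @ u\<close> reduces to
  \<open>u\<close>, and it is a permutation of \<open>m @ m @ v\<close>, which reduces to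
  \<open>v\<close>.\<close>

lemma wval_parity:
  assumes "set u = set v" "\<And>x. even (count_list u x + count_list v x)"
  shows "wval u = wval v"
proof -
  obtain m where m: "mset (u @ v) = mset (m @ m)" "set m = set (u @ v)"
    using even_counts_double[of "u @ v"] assms(2) by auto
  have "wval u = wval (v @ v @ u)"
    using wval_absorb_double[of v u] assms(1) by simp
  also have "\<dots> = wval (m @ m @ v)"
    using m(1) by (intro wval_perm) (simp add: ac_simps)
  also have "\<dots> = wval v"
    using m(2) assms(1) by (intro wval_absorb_double) simp
  finally show ?thesis .
qed

text \<open>The ternary law keeps the words below \<open>t\<close> closed under threefold
  concatenation. Nonemptiness is carried through the induction because \<open>word_trm []\<close> is
  junk.\<close>

lemma odd_concats_le:
  assumes "c \<in> odd_concats (words t)"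
  shows "le (wval c) (val t)"
proof -
  have "c \<noteq> [] \<and> le (wval c) (val t)"
    using assms
  proof (induction rule: odd_concats.induct)
    case (base w)
    then show ?case using words_nonempty wval_le_val by blast
  next
    case (step u v w)
    let ?m = "smul A (wval u) (smul A (wval v) (wval w))"
      and ?s = "sadd A (wval u) (sadd A (wval v) (wval w))"
    have "le ?m ?s"
      unfolding le_def by (simp add: ternary)
    moreover have "le ?s (val t)"
      using step.IH by (simp add: add_least)
    ultimately have "le ?m (val t)"
      using le_trans[of ?m ?s "val t"] by simp
    then show ?case using step.IH by (simp add: wval_append)
  qed
  then show ?thesis by blast
qed

end

section \<open>The finite bases for orders one and two\<close>

definition ternary_basis :: "(trm \<times> trm) set" where
  "ternary_basis = (let x = Var 0; y = Var 1; z = Var 2 in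
    {(Add (Add x y) z, Add x (Add y z)), (Add x y, Add y x), (Add x x, x),
     (Mul (Mul x y) z, Mul x (Mul y z)), (Mul x y, Mul y x),
     (Mul x (Add y z), Add (Mul x y) (Mul x z)), (Mul x (Mul x x), x),
     (Add (Mul x (Mul y z)) (Add x (Add y z)), Add x (Add y z))})"

definition absorption :: "trm \<times> trm" where
  "absorption = (Add (Var 0) (Mul (Var 0) (Var 1)), Var 0)"

lemma satisfies_three:
  assumes "satisfies A (s, t)" "x \<in> carrier A" "y \<in> carrier A" "z \<in> carrier A"
  shows "trm_val A (\<lambda>n. if n = 0 then x else if n = 1 then y else z) s =
    trm_val A (\<lambda>n. if n = 0 then x else if n = 1 then y else z) t"
  using assms by (simp add: satisfies_def)

lemma ternary_ai_semiring_of_basis: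
  assumes "closed_alg A" and sat: "\<And>e. e \<in> ternary_basis \<Longrightarrow> satisfies A e"
  shows "ternary_ai_semiring A"
proof -
  interpret closed_alg A by fact
  have ev: "trm_val A (\<lambda>n. if n = 0 then x else if n = 1 then y else z) s =
      trm_val A (\<lambda>n. if n = 0 then x else if n = 1 then y else z) t"
    if "(s, t) \<in> ternary_basis" "x \<in> carrier A" "y \<in> carrier A" "z \<in> carrier A" for s t x y z
    using satisfies_three[OF sat[OF that(1)] that(2-4)] .
  note b = ternary_basis_def Let_def
  show ?thesis
  proof
    fix x y z assume x: "x \<in> carrier A" and y: "y \<in> carrier A" and z: "z \<in> carrier A"
    show "sadd A (sadd A x y) z = sadd A x (sadd A y z)"
      using ev[of "Add (Add (Var 0) (Var 1)) (Var 2)" "Add (Var 0) (Add (Var 1) (Var 2))" x y z] x y z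
      by (simp add: b)
    show "smul A (smul A x y) z = smul A x (smul A y z)"
      using ev[of "Mul (Mul (Var 0) (Var 1)) (Var 2)" "Mul (Var 0) (Mul (Var 1) (Var 2))" x y z] x y z
      by (simp add: b)
    show "smul A x (sadd A y z) = sadd A (smul A x y) (smul A x z)"
      using ev[of "Mul (Var 0) (Add (Var 1) (Var 2))"
          "Add (Mul (Var 0) (Var 1)) (Mul (Var 0) (Var 2))" x y z] x y z
      by (simp add: b)
    show "sadd A (smul A x (smul A y z)) (sadd A x (sadd A y z)) = sadd A x (sadd A y z)"
      using ev[of "Add (Mul (Var 0) (Mul (Var 1) (Var 2))) (Add (Var 0) (Add (Var 1) (Var 2)))"
          "Add (Var 0) (Add (Var 1) (Var 2))" x y z] x y z
      by (simp add: b)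
  next
    fix x y assume x: "x \<in> carrier A" and y: "y \<in> carrier A"
    show "sadd A x y = sadd A y x"
      using ev[of "Add (Var 0) (Var 1)" "Add (Var 1) (Var 0)" x y y] x y by (simp add: b)
    show "smul A x y = smul A y x"
      using ev[of "Mul (Var 0) (Var 1)" "Mul (Var 1) (Var 0)" x y y] x y by (simp add: b)
  next
    fix x assume x: "x \<in> carrier A"
    show "sadd A x x = x"
      using ev[of "Add (Var 0) (Var 0)" "Var 0" x x x] x by (simp add: b)
    show "smul A x (smul A x x) = x"
      using ev[of "Mul (Var 0) (Mul (Var 0) (Var 0))" "Var 0" x x x] x by (simp add: b)
  next
    fix x y z assume x: "x \<in> carrier A" and y: "y \<in> carrier A" and z: "z \<in> carrier A"
    \<comment> \<open>The basis states the left distributive law; the right one follows by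
      commutativity.\<close>
    have comm: "smul A u v = smul A v u" if "u \<in> carrier A" "v \<in> carrier A" for u v
      using ev[of "Mul (Var 0) (Var 1)" "Mul (Var 1) (Var 0)" u v v] that by (simp add: b)
    show "smul A (sadd A x y) z = sadd A (smul A x z) (smul A y z)"
      using ev[of "Mul (Var 0) (Add (Var 1) (Var 2))"
          "Add (Mul (Var 0) (Var 1)) (Mul (Var 0) (Var 2))" z x y] x y z comm add_closed
      by (simp add: b)
  qed
qed

context group
begin

lemma power_alg_inequality:
  assumes "satisfies (power_alg G) (s, t)" "w \<in> words s" "\<And>x. \<phi> x \<subseteq> carrier G"
  shows "trm_val (power_alg G) \<phi> (word_trm w) \<subseteq> trm_val (power_alg G) \<phi> t"
proof -
  have "trm_val (power_alg G) \<phi> (word_trm w) \<subseteq> trm_val (power_alg G) \<phi> s"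
    using trm_val_power_alg_words[of \<phi> s, OF assms(3)] assms(2) by blast
  also have "\<dots> = trm_val (power_alg G) \<phi> t"
    using assms(1,3) by (simp add: satisfies_def power_alg_def)
  finally show ?thesis .
qed

text \<open>Among three elements of \<open>G\<close> two coincide, and squares are trivial, so a
  product of three elements is one of them.\<close>

lemma ternary_ai_semiring_power_alg:
  assumes "finite (carrier G)" "order G \<le> 2"
  shows "ternary_ai_semiring (power_alg G)"
proof -
  interpret P: ai_semiring "power_alg G" by (rule ai_semiring_power_alg)
  have three: "a = b \<or> a = c \<or> b = c"
    if "a \<in> carrier G" "b \<in> carrier G" "c \<in> carrier G" for a b c
  proof (rule ccontr)
    assume "\<not> ?thesis"
    then have "card {a, b, c} = 3" by auto
    moreover have "card {a, b, c} \<le> order G"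
      unfolding order_def using that by (intro card_mono assms(1)) auto
    ultimately show False using assms(2) by simp
  qed
  \<comment> \<open>Two of \<open>\<one>\<close>, \<open>a\<close> and \<open>a \<otimes> a\<close>
    coincide, and each case gives the claim.\<close>
  have sq: "a \<otimes> a = \<one>" if "a \<in> carrier G" for a
    using three[of \<one> a "a \<otimes> a"] that by (metis l_cancel_one m_closed one_closed)
  have comm: "a \<otimes> b = b \<otimes> a" if "a \<in> carrier G" "b \<in> carrier G" for a b
    using three[of \<one> a b] that by auto
  have tern: "a \<otimes> (b \<otimes> c) \<in> {a, b, c}"
    if abc: "a \<in> carrier G" "b \<in> carrier G" "c \<in> carrier G" for a b c
  proof -
    consider "a = b" | "a = c" | "b = c" using three[OF abc] by blast
    then show ?thesis
    proof cases
      case 1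
      then show ?thesis using abc sq m_assoc[of a a c] by simp
    next
      case 2
      then show ?thesis using abc sq comm[of b a] m_assoc[of a a b] by simp
    next
      case 3
      then show ?thesis using abc sq by simp
    qed
  qed
  have set_comm: "X <#> Y \<subseteq> Y <#> X" if "X \<subseteq> carrier G" "Y \<subseteq> carrier G" for X Y
  proof
    fix z assume "z \<in> X <#> Y"
    then obtain a b where "a \<in> X" "b \<in> Y" "z = a \<otimes> b" unfolding set_mult_def by blast
    moreover from this have "z = b \<otimes> a" using that comm by blast
    ultimately show "z \<in> Y <#> X" unfolding set_mult_def by blast
  qed
  have set_tern: "X <#> (Y <#> Z) \<subseteq> X \<union> (Y \<union> Z)"
    if "X \<subseteq> carrier G" "Y \<subseteq> carrier G" "Z \<subseteq> carrier G" for X Y Z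
  proof
    fix z assume "z \<in> X <#> (Y <#> Z)"
    then obtain a b c where "a \<in> X" "b \<in> Y" "c \<in> Z" "z = a \<otimes> (b \<otimes> c)"
      unfolding set_mult_def by blast
    moreover from this have "z \<in> {a, b, c}" using that tern by blast
    ultimately show "z \<in> X \<union> (Y \<union> Z)" by auto
  qed
  show ?thesis
  proof
    fix X Y Z :: "'a set"
    assume X: "X \<in> carrier (power_alg G)" and Y: "Y \<in> carrier (power_alg G)"
    show "smul (power_alg G) X Y = smul (power_alg G) Y X"
      using X Y set_comm by (simp add: power_alg_def subset_antisym)
    assume Z: "Z \<in> carrier (power_alg G)"
    show "sadd (power_alg G) (smul (power_alg G) X (smul (power_alg G) Y Z))
        (sadd (power_alg G) X (sadd (power_alg G) Y Z)) =
      sadd (power_alg G) X (sadd (power_alg G) Y Z)"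
      using X Y Z set_tern[of X Y Z] by (simp add: power_alg_def Un_absorb1)
  next
    fix X :: "'a set"
    assume X: "X \<in> carrier (power_alg G)"
    have "X <#> (X <#> X) \<subseteq> X"
      using X set_tern[of X X X] by (simp add: power_alg_def)
    moreover have "X \<subseteq> X <#> (X <#> X)"
    proof
      fix a assume "a \<in> X"
      moreover from this have "a = a \<otimes> (a \<otimes> a)" using X sq by (auto simp: power_alg_def)
      ultimately show "a \<in> X <#> (X <#> X)" unfolding set_mult_def by blast
    qed
    ultimately show "smul (power_alg G) X (smul (power_alg G) X X) = X"
      by (simp add: power_alg_def)
  qed
qed

lemma satisfies_ternary_basis:
  assumes "finite (carrier G)" "order G \<le> 2" "e \<in> ternary_basis"
  shows "satisfies (power_alg G) e"
proof -
  interpret ternary_ai_semiring "power_alg G"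
    using ternary_ai_semiring_power_alg assms(1,2) .
  show ?thesis
    using assms(3) add_assoc add_comm add_idem mul_assoc mul_comm distrib_left cube ternary
    by (auto simp: ternary_basis_def Let_def satisfies_def)
qed

text \<open>By completeness, algebras over \<open>trm set\<close> suffice. There a term is the least
  upper bound of its words, so bounding words by terms in both directions gives equality.\<close>

lemma finitely_based_criterion:
  assumes "finite E" "\<And>e. e \<in> E \<Longrightarrow> satisfies (power_alg G) e" "ternary_basis \<subseteq> E"
    and "\<And>(A :: trm set alg) \<phi> s t w. \<lbrakk>ternary_valuation A \<phi>; \<forall>e\<in>E. satisfies A e;
      satisfies (power_alg G) (s, t); w \<in> words s\<rbrakk>
      \<Longrightarrow> ternary_valuation.le A (trm_val A \<phi> (word_trm w)) (trm_val A \<phi> t)"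
  shows "finitely_based (power_alg G)"
  unfolding finitely_based_def
proof (intro exI[of _ E] conjI ballI allI impI)
  fix s t assume st: "satisfies (power_alg G) (s, t)"
  then have ts: "satisfies (power_alg G) (t, s)" by (simp add: satisfies_def)
  show "deducible E s t"
  proof (rule deducible_complete)
    fix A :: "trm set alg" assume A: "closed_alg A" "\<forall>e\<in>E. satisfies A e"
    show "satisfies A (s, t)"
      unfolding satisfies_def
    proof (intro allI impI)
      fix \<phi> :: "nat \<Rightarrow> trm set" assume \<phi>: "\<forall>x. \<phi> x \<in> carrier A"
      have "ternary_ai_semiring A"
        using ternary_ai_semiring_of_basis[OF A(1)] A(2) assms(3) by blast
      then interpret ternary_valuation A \<phi>
        using \<phi> by (simp add: ternary_valuation_def ternary_valuation_axioms_def)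
      have "le (val s) (val t)"
        by (rule val_le) (use assms(4)[OF ternary_valuation_axioms A(2) st] in simp_all)
      moreover have "le (val t) (val s)"
        by (rule val_le) (use assms(4)[OF ternary_valuation_axioms A(2) ts] in simp_all)
      ultimately show "trm_val A \<phi> (fst (s, t)) = trm_val A \<phi> (snd (s, t))"
        by (simp add: le_antisym)
    qed
  qed
qed (use assms(1,2) in auto)

lemma finite_ternary_basis: "finite ternary_basis"
  by (simp add: ternary_basis_def Let_def)

text \<open>The covering word lies below \<open>t\<close> by the ternary law, and it has the value
  of \<open>w\<close> because letters and parities agree.\<close>

lemma finitely_based_order_two:
  assumes "finite (carrier G)" "order G = 2"
  shows "finitely_based (power_alg G)"
proof (rule finitely_based_criterion[of ternary_basis])
  fix A :: "trm set alg" and \<phi> s t w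
  assume A: "ternary_valuation A \<phi>" and st: "satisfies (power_alg G) (s, t)"
    and w: "w \<in> words s"
  interpret ternary_valuation A \<phi> by fact
  have "carrier G \<noteq> {\<one>}" using assms(2) by (auto simp: order_def)
  then obtain g where g: "g \<in> carrier G" "g \<noteq> \<one>" using one_closed by blast
  have "g \<otimes> g = \<one>"
  proof -
    have "g [^] (2::nat) = \<one>"
      using pow_order_eq_1[OF g(1)] assms(2) by simp
    then show ?thesis using g(1) by (simp add: numeral_2_eq_2)
  qed
  from covering_word_of_inequality[OF g this words_nonempty[OF w]]
  obtain c where c: "c \<in> odd_concats (words t)" "set c = set w"
    "\<And>x. even (count_list c x + count_list w x)"
    using power_alg_inequality[OF st w] by blast
  show "le (val (word_trm w)) (val t)"
    using odd_concats_le[OF c(1)] wval_parity[OF c(2,3)] by simp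
qed (use assms satisfies_ternary_basis finite_ternary_basis in auto)

text \<open>The algebra is the two-element lattice, with intersection as product. A valid inequality
  requires a word \<open>u\<close> of \<open>t\<close> with letters from \<open>w\<close> only; then
  \<open>w = u (u w)\<close>, which absorption puts below \<open>u\<close>.\<close>

lemma finitely_based_order_one:
  assumes "finite (carrier G)" "order G = 1"
  shows "finitely_based (power_alg G)"
proof (rule finitely_based_criterion[of "insert absorption ternary_basis"])
  have carrier: "carrier G = {\<one>}"
    using assms(2) order_one_triv_iff by (simp add: order_def)
  have "X <#> Y \<subseteq> X" if "X \<subseteq> carrier G" "Y \<subseteq> carrier G" for X Y
  proof
    fix z assume "z \<in> X <#> Y"
    then obtain a b where "a \<in> X" "b \<in> Y" "z = a \<otimes> b" unfolding set_mult_def by blast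
    moreover from this have "b = \<one>" "a \<in> carrier G" using that carrier by blast+
    ultimately show "z \<in> X" by simp
  qed
  then have "satisfies (power_alg G) absorption"
    by (simp add: absorption_def satisfies_def power_alg_def Un_absorb2)
  then show "satisfies (power_alg G) e" if "e \<in> insert absorption ternary_basis" for e
    using that satisfies_ternary_basis[OF assms(1), of e] assms(2) by auto
next
  fix A :: "trm set alg" and \<phi> s t w
  assume A: "ternary_valuation A \<phi>" "\<forall>e\<in>insert absorption ternary_basis. satisfies A e"
    and st: "satisfies (power_alg G) (s, t)" and w: "w \<in> words s"
  interpret ternary_valuation A \<phi> by fact
  define \<psi> where "\<psi> x = (if x \<in> set w then {\<one>} else {})" for x
  have \<psi>: "\<psi> x \<subseteq> carrier G" for x by (simp add: \<psi>_def)
  have "\<one> \<in> trm_val (power_alg G) \<psi> (word_trm w)"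
    using trm_val_word_trm_one[of w \<psi>] words_nonempty[OF w] by (simp add: \<psi>_def)
  then have "\<one> \<in> trm_val (power_alg G) \<psi> t"
    using power_alg_inequality[OF st w, of \<psi>] \<psi> by blast
  then obtain u where u: "u \<in> words t" "\<one> \<in> trm_val (power_alg G) \<psi> (word_trm u)"
    using trm_val_power_alg_words[of \<psi> t, OF \<psi>] by blast
  then have "set u \<subseteq> set w"
    using trm_val_word_trm_empty[of _ u \<psi>] by (fastforce simp: \<psi>_def)
  then have "wval w = wval (u @ u @ w)"
    by (simp add: wval_absorb_double)
  also have "\<dots> = smul A (wval u) (wval (u @ w))"
    using words_nonempty[OF w] words_nonempty[OF u(1)] by (simp add: wval_append)
  finally have wu: "wval w = smul A (wval u) (wval (u @ w))" .
  have "sadd A (wval u) (smul A (wval u) (wval (u @ w))) = wval u"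
    using A(2) satisfies_three[of A "fst absorption" "snd absorption" "wval u" "wval (u @ w)" "wval u"]
    by (simp add: absorption_def)
  then have "le (wval w) (wval u)"
    unfolding le_def wu using add_comm[of "wval u" "smul A (wval u) (wval (u @ w))"] by simp
  then show "le (val (word_trm w)) (val t)"
    using le_trans[of "wval w" "wval u" "val t"] wval_le_val[OF u(1)] by simp
qed (use finite_ternary_basis in auto)

end

theorem corollary1p3:
  fixes G :: "('a, 'b) monoid_scheme"
  assumes "group G" and "finite (carrier G)"
  shows "finitely_based (power_alg G) \<longleftrightarrow> order G \<le> 2"
proof -
  interpret group G by fact
  have "order G > 0" using assms(2) by (rule order_gt_0_iff_finite[THEN iffD2])
  then consider "order G = 1" | "order G = 2" | "3 \<le> order G" by linarith
  then show ?thesis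
    using finitely_based_order_one finitely_based_order_two not_finitely_based_power_alg assms(2)
    by cases auto
qed

end
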